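(* Let $\mathcal{C}$ be a direct Reedy category and let $\mathbf{M}$ be a model category; equip $\mathbf{M}^{\mathcal{C}}=\mathrm{Fun}(\mathcal{C},\mathbf{M})$ with the Reedy model structure. A morphism $X\to Y$ in $\mathbf{M}^{\mathcal{C}}$ is flat if $X_a\to Y_a$ is flat in $\mathbf{M}$ for every $a\in\mathcal{C}$. If $\mathbf{M}$ is strong left proper, then also $\mathbf{M}^{\mathcal{C}}$ is strong left proper.
   Context: A direct Reedy category is a non-empty small category $\mathcal{C}$ with a degree function $\mathrm{Ob}(\mathcal{C})\to\mathbb{N}$ such that every non-identity morphism strictly raises degree. For $a\in\mathcal{C}$, $[\mathcal{C},a)$ is the category whose objects are the non-identity morphisms $b\to a$ and whose morphisms are the morphisms over $a$. For a diagram $X\colon\mathcal{C}\to\mathbf{M}$, the latching object is $L_aX=\mathrm{colim}_{(b\to a)\in[\mathcal{C},a)}X_b$. In the Reedy model structure on $\mathbf{M}^{\mathcal{C}}$ weak equivalences and fibrations are objectwise, and $X\to Y$ is a cofibration iff $X_a\amalg_{L_aX}L_aY\to Y_a$ is a cofibration in $\mathbf{M}$ for every $a\in\mathcal{C}$. For an object $A$ of a model category $\mathbf{M}$, $\mathbf{M}_A$ is the undercategory of maps $A\to B$, with the model structure whose cofibrations, fibrations and weak equivalences are those of $\mathbf{M}$. A morphism $A\to B$ in $\mathbf{M}$ is called flat if the push-out functor $-\amalg_AB\colon\mathbf{M}_A\to\mathbf{M}_B$ preserves pull-back squares of trivial fibrations (i.e. it sends trivial fibrations to trivial fibrations, and pull-back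 squares $C\times_DE$ with $C\to D$ a trivial fibration to pull-back squares). $\mathbf{M}$ is strong left proper if every cofibration is flat. *)

theory Defs
  imports Main "HOL-Library.FuncSet" "HOL-Library.Infinite_Typeclass"
begin

text \<open>
  \<^term>\<open>Comp K g f\<close> is the composite of \<open>f\<close> followed by \<open>g\<close>; it is meaningful only
  when the codomain of \<open>f\<close> is the domain of \<open>g\<close>.
\<close>

record ('o, 'm) cat =
  Ob :: "'o set"
  Ar :: "'m set"
  Dom :: "'m \<Rightarrow> 'o"
  Cod :: "'m \<Rightarrow> 'o"
  Id :: "'o \<Rightarrow> 'm"
  Comp :: "'m \<Rightarrow> 'm \<Rightarrow> 'm"

locale category =
  fixes K :: "('o, 'm, 'x) cat_scheme"
  assumes Dom_Ob: "f \<in> Ar K \<Longrightarrow> Dom K f \<in> Ob K"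
    and Cod_Ob: "f \<in> Ar K \<Longrightarrow> Cod K f \<in> Ob K"
    and Id_Ar: "x \<in> Ob K \<Longrightarrow> Id K x \<in> Ar K"
    and Dom_Id: "x \<in> Ob K \<Longrightarrow> Dom K (Id K x) = x"
    and Cod_Id: "x \<in> Ob K \<Longrightarrow> Cod K (Id K x) = x"
    and Comp_Ar: "\<lbrakk>f \<in> Ar K; g \<in> Ar K; Cod K f = Dom K g\<rbrakk> \<Longrightarrow> Comp K g f \<in> Ar K"
    and Dom_Comp: "\<lbrakk>f \<in> Ar K; g \<in> Ar K; Cod K f = Dom K g\<rbrakk> \<Longrightarrow> Dom K (Comp K g f) = Dom K f"
    and Cod_Comp: "\<lbrakk>f \<in> Ar K; g \<in> Ar K; Cod K f = Dom K g\<rbrakk> \<Longrightarrow> Cod K (Comp K g f) = Cod K g"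
    and Comp_Id: "f \<in> Ar K \<Longrightarrow> Comp K f (Id K (Dom K f)) = f"
    and Id_Comp: "f \<in> Ar K \<Longrightarrow> Comp K (Id K (Cod K f)) f = f"
    and Comp_assoc: "\<lbrakk>f \<in> Ar K; g \<in> Ar K; h \<in> Ar K; Cod K f = Dom K g; Cod K g = Dom K h\<rbrakk>
      \<Longrightarrow> Comp K (Comp K h g) f = Comp K h (Comp K g f)"

definition Hom :: "('o, 'm, 'x) cat_scheme \<Rightarrow> 'o \<Rightarrow> 'o \<Rightarrow> 'm set"
  where "Hom K x y = {f \<in> Ar K. Dom K f = x \<and> Cod K f = y}"

record ('o, 'm, 'p, 'n) fnctr =
  FOb :: "'o \<Rightarrow> 'p"
  FAr :: "'m \<Rightarrow> 'n"

definition is_functor ::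
    "('o, 'm, 'x) cat_scheme \<Rightarrow> ('p, 'n, 'y) cat_scheme \<Rightarrow> ('o, 'm, 'p, 'n) fnctr \<Rightarrow> bool"
  where "is_functor C D F \<longleftrightarrow>
    (\<forall>x\<in>Ob C. FOb F x \<in> Ob D) \<and>
    (\<forall>f\<in>Ar C. FAr F f \<in> Hom D (FOb F (Dom C f)) (FOb F (Cod C f))) \<and>
    (\<forall>x\<in>Ob C. FAr F (Id C x) = Id D (FOb F x)) \<and>
    (\<forall>f\<in>Ar C. \<forall>g\<in>Ar C. Cod C f = Dom C g \<longrightarrow>
      FAr F (Comp C g f) = Comp D (FAr F g) (FAr F f))"

record ('o, 'm, 'p, 'n) nat_trans =
  NDom :: "('o, 'm, 'p, 'n) fnctr"
  NCod :: "('o, 'm, 'p, 'n) fnctr"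
  Cmp :: "'o \<Rightarrow> 'n"

text \<open>
  In the category \<open>Fun(C, D)\<close>, functors and transformations are required to be extensional
  outside the objects and arrows of \<open>C\<close>, so that equality in HOL is equality of functors
  and of natural transformations.
\<close>

definition fun_objects ::
    "('o, 'm, 'x) cat_scheme \<Rightarrow> ('p, 'n, 'y) cat_scheme \<Rightarrow> ('o, 'm, 'p, 'n) fnctr set"
  where "fun_objects C D =
    {F. is_functor C D F \<and> FOb F \<in> extensional (Ob C) \<and> FAr F \<in> extensional (Ar C)}"

definition fun_arrows ::
    "('o, 'm, 'x) cat_scheme \<Rightarrow> ('p, 'n, 'y) cat_scheme \<Rightarrow> ('o, 'm, 'p, 'n) nat_trans set"
  where "fun_arrows C D =
    {t. NDom t \<in> fun_objects C D \<and> NCod t \<in> fun_objects C D \<and> Cmp t \<in> extensional (Ob C) \<and>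
        (\<forall>a\<in>Ob C. Cmp t a \<in> Hom D (FOb (NDom t) a) (FOb (NCod t) a)) \<and>
        (\<forall>f\<in>Ar C. Comp D (Cmp t (Cod C f)) (FAr (NDom t) f) =
                   Comp D (FAr (NCod t) f) (Cmp t (Dom C f)))}"

definition fun_cat ::
    "('o, 'm, 'x) cat_scheme \<Rightarrow> ('p, 'n, 'y) cat_scheme \<Rightarrow>
      (('o, 'm, 'p, 'n) fnctr, ('o, 'm, 'p, 'n) nat_trans) cat"
  where "fun_cat C D =
    \<lparr>Ob = fun_objects C D,
     Ar = fun_arrows C D,
     Dom = NDom,
     Cod = NCod,
     Id = (\<lambda>F. \<lparr>NDom = F, NCod = F, Cmp = (\<lambda>a\<in>Ob C. Id D (FOb F a))\<rparr>),
     Comp = (\<lambda>t s. \<lparr>NDom = NDom s, NCod = NCod t,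
       Cmp = (\<lambda>a\<in>Ob C. Comp D (Cmp t a) (Cmp s a))\<rparr>)\<rparr>"

definition is_cone ::
    "('j, 'k, 'x) cat_scheme \<Rightarrow> ('o, 'm, 'y) cat_scheme \<Rightarrow> ('j, 'k, 'o, 'm) fnctr \<Rightarrow>
      'o \<Rightarrow> ('j \<Rightarrow> 'm) \<Rightarrow> bool"
  where "is_cone J K D L p \<longleftrightarrow>
    L \<in> Ob K \<and> (\<forall>j\<in>Ob J. p j \<in> Hom K L (FOb D j)) \<and>
    (\<forall>u\<in>Ar J. Comp K (FAr D u) (p (Dom J u)) = p (Cod J u))"

definition is_limit ::
    "('j, 'k, 'x) cat_scheme \<Rightarrow> ('o, 'm, 'y) cat_scheme \<Rightarrow> ('j, 'k, 'o, 'm) fnctr \<Rightarrow>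
      'o \<Rightarrow> ('j \<Rightarrow> 'm) \<Rightarrow> bool"
  where "is_limit J K D L p \<longleftrightarrow>
    is_cone J K D L p \<and>
    (\<forall>L' p'. is_cone J K D L' p' \<longrightarrow>
      (\<exists>!h. h \<in> Hom K L' L \<and> (\<forall>j\<in>Ob J. Comp K (p j) h = p' j)))"

definition is_cocone ::
    "('j, 'k, 'x) cat_scheme \<Rightarrow> ('o, 'm, 'y) cat_scheme \<Rightarrow> ('j, 'k, 'o, 'm) fnctr \<Rightarrow>
      'o \<Rightarrow> ('j \<Rightarrow> 'm) \<Rightarrow> bool"
  where "is_cocone J K D L i \<longleftrightarrow>
    L \<in> Ob K \<and> (\<forall>j\<in>Ob J. i j \<in> Hom K (FOb D j) L) \<and>
    (\<forall>u\<in>Ar J. Comp K (i (Cod J u)) (FAr D u) = i (Dom J u))"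

definition is_colimit ::
    "('j, 'k, 'x) cat_scheme \<Rightarrow> ('o, 'm, 'y) cat_scheme \<Rightarrow> ('j, 'k, 'o, 'm) fnctr \<Rightarrow>
      'o \<Rightarrow> ('j \<Rightarrow> 'm) \<Rightarrow> bool"
  where "is_colimit J K D L i \<longleftrightarrow>
    is_cocone J K D L i \<and>
    (\<forall>L' i'. is_cocone J K D L' i' \<longrightarrow>
      (\<exists>!h. h \<in> Hom K L L' \<and> (\<forall>j\<in>Ob J. Comp K h (i j) = i' j)))"

definition colim ::
    "('j, 'k, 'x) cat_scheme \<Rightarrow> ('o, 'm, 'y) cat_scheme \<Rightarrow> ('j, 'k, 'o, 'm) fnctr \<Rightarrow>
      'o \<times> ('j \<Rightarrow> 'm)"
  where "colim J K D = (SOME (L, i). is_colimit J K D L i)"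

text \<open>
  The square with \<open>p : C \<rightarrow> D\<close>, \<open>q : E \<rightarrow> D\<close>, \<open>r : P \<rightarrow> C\<close>, \<open>s : P \<rightarrow> E\<close> and
  \<open>p r = q s\<close> exhibits \<open>P\<close> as \<open>C \<times>\<^sub>D E\<close>.
\<close>

definition is_pullback :: "('o, 'm, 'x) cat_scheme \<Rightarrow> 'm \<Rightarrow> 'm \<Rightarrow> 'm \<Rightarrow> 'm \<Rightarrow> bool"
  where "is_pullback K p q r s \<longleftrightarrow>
    p \<in> Ar K \<and> q \<in> Ar K \<and> r \<in> Ar K \<and> s \<in> Ar K \<and>
    Cod K p = Cod K q \<and> Dom K r = Dom K s \<and> Cod K r = Dom K p \<and> Cod K s = Dom K q \<and>
    Comp K p r = Comp K q s \<and>
    (\<forall>r'\<in>Ar K. \<forall>s'\<in>Ar K.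
      Dom K r' = Dom K s' \<and> Cod K r' = Dom K p \<and> Cod K s' = Dom K q \<and>
      Comp K p r' = Comp K q s' \<longrightarrow>
      (\<exists>!h. h \<in> Hom K (Dom K r') (Dom K r) \<and> Comp K r h = r' \<and> Comp K s h = s'))"

text \<open>
  The square with \<open>f : A \<rightarrow> B\<close>, \<open>u : A \<rightarrow> C\<close>, \<open>i : B \<rightarrow> P\<close>, \<open>j : C \<rightarrow> P\<close> and
  \<open>i f = j u\<close> exhibits \<open>P\<close> as the push-out of \<open>B\<close> and \<open>C\<close> under \<open>A\<close>.
\<close>

definition is_pushout :: "('o, 'm, 'x) cat_scheme \<Rightarrow> 'm \<Rightarrow> 'm \<Rightarrow> 'm \<Rightarrow> 'm \<Rightarrow> bool"
  where "is_pushout K f u i j \<longleftrightarrow>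
    f \<in> Ar K \<and> u \<in> Ar K \<and> i \<in> Ar K \<and> j \<in> Ar K \<and>
    Dom K f = Dom K u \<and> Cod K i = Cod K j \<and> Dom K i = Cod K f \<and> Dom K j = Cod K u \<and>
    Comp K i f = Comp K j u \<and>
    (\<forall>i'\<in>Ar K. \<forall>j'\<in>Ar K.
      Cod K i' = Cod K j' \<and> Dom K i' = Cod K f \<and> Dom K j' = Cod K u \<and>
      Comp K i' f = Comp K j' u \<longrightarrow>
      (\<exists>!h. h \<in> Hom K (Cod K i) (Cod K i') \<and> Comp K h i = i' \<and> Comp K h j = j'))"

definition pushout :: "('o, 'm, 'x) cat_scheme \<Rightarrow> 'm \<Rightarrow> 'm \<Rightarrow> 'm \<times> 'm"
  where "pushout K f u = (SOME (i, j). is_pushout K f u i j)"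

text \<open>The map out of the chosen push-out of \<open>f\<close> and \<open>u\<close> determined by \<open>i'\<close> and \<open>j'\<close>.\<close>

definition pushout_desc :: "('o, 'm, 'x) cat_scheme \<Rightarrow> 'm \<Rightarrow> 'm \<Rightarrow> 'm \<Rightarrow> 'm \<Rightarrow> 'm"
  where "pushout_desc K f u i' j' =
    (THE h. h \<in> Hom K (Cod K (fst (pushout K f u))) (Cod K i') \<and>
            Comp K h (fst (pushout K f u)) = i' \<and> Comp K h (snd (pushout K f u)) = j')"

record ('o, 'm) model_cat = "('o, 'm) cat" +
  Cof :: "'m set"
  Fib :: "'m set"
  Weq :: "'m set"

definition TCof :: "('o, 'm, 'x) model_cat_scheme \<Rightarrow> 'm set"
  where "TCof M = Cof M \<inter> Weq M"

definition TFib :: "('o, 'm, 'x) model_cat_scheme \<Rightarrow> 'm set"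
  where "TFib M = Fib M \<inter> Weq M"

text \<open>\<open>g\<close> is a retract of \<open>f\<close> in the category of arrows of \<open>K\<close>.\<close>

definition retract_of :: "('o, 'm, 'x) cat_scheme \<Rightarrow> 'm \<Rightarrow> 'm \<Rightarrow> bool"
  where "retract_of K g f \<longleftrightarrow> f \<in> Ar K \<and> g \<in> Ar K \<and>
    (\<exists>i r j s. i \<in> Hom K (Dom K g) (Dom K f) \<and> r \<in> Hom K (Dom K f) (Dom K g) \<and>
               j \<in> Hom K (Cod K g) (Cod K f) \<and> s \<in> Hom K (Cod K f) (Cod K g) \<and>
               Comp K r i = Id K (Dom K g) \<and> Comp K s j = Id K (Cod K g) \<and>
               Comp K f i = Comp K j g \<and> Comp K g r = Comp K s f)"

definition has_lifting :: "('o, 'm, 'x) cat_scheme \<Rightarrow> 'm \<Rightarrow> 'm \<Rightarrow> bool"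
  where "has_lifting K i p \<longleftrightarrow>
    (\<forall>u\<in>Hom K (Dom K i) (Dom K p). \<forall>v\<in>Hom K (Cod K i) (Cod K p).
      Comp K p u = Comp K v i \<longrightarrow>
      (\<exists>h\<in>Hom K (Cod K i) (Dom K p). Comp K h i = u \<and> Comp K p h = v))"

text \<open>
  The type \<open>'u\<close> is the universe of small sets: a category is small if its objects and arrows
  are elements of \<open>'u\<close>.  Instantiated with an infinite \<open>'u\<close>, this covers the shapes of
  pull-backs and push-outs, and every category with at most \<open>|'u \<times> 'u \<times> 'u| = |'u|\<close> arrows, such
  as the latching categories of a small category.
\<close>

definition has_small_limits :: "'u itself \<Rightarrow> ('o, 'm, 'x) cat_scheme \<Rightarrow> bool"
  where "has_small_limits U K \<longleftrightarrow>
    (\<forall>(J :: ('u, 'u) cat) D. category J \<and> is_functor J K D \<longrightarrow> (\<exists>L p. is_limit J K D L p))"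

definition has_small_colimits :: "'u itself \<Rightarrow> ('o, 'm, 'x) cat_scheme \<Rightarrow> bool"
  where "has_small_colimits U K \<longleftrightarrow>
    (\<forall>(J :: ('u, 'u) cat) D. category J \<and> is_functor J K D \<longrightarrow> (\<exists>L i. is_colimit J K D L i))"

text \<open>No functoriality of the factorizations is required.\<close>

locale model_category = category M
  for M :: "('o, 'm, 'x) model_cat_scheme" +
  fixes U :: "'u itself"
  assumes Cof_Ar: "Cof M \<subseteq> Ar M"
    and Fib_Ar: "Fib M \<subseteq> Ar M"
    and Weq_Ar: "Weq M \<subseteq> Ar M"
    and complete: "has_small_limits U M"
    and cocomplete: "has_small_colimits U M"
    and Weq_comp: "\<lbrakk>f \<in> Ar M; g \<in> Ar M; Cod M f = Dom M g; f \<in> Weq M; g \<in> Weq M\<rbrakk>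
      \<Longrightarrow> Comp M g f \<in> Weq M"
    and Weq_cancel_left: "\<lbrakk>f \<in> Ar M; g \<in> Ar M; Cod M f = Dom M g; g \<in> Weq M; Comp M g f \<in> Weq M\<rbrakk>
      \<Longrightarrow> f \<in> Weq M"
    and Weq_cancel_right: "\<lbrakk>f \<in> Ar M; g \<in> Ar M; Cod M f = Dom M g; f \<in> Weq M; Comp M g f \<in> Weq M\<rbrakk>
      \<Longrightarrow> g \<in> Weq M"
    and Cof_retract: "\<lbrakk>f \<in> Cof M; retract_of M g f\<rbrakk> \<Longrightarrow> g \<in> Cof M"
    and Fib_retract: "\<lbrakk>f \<in> Fib M; retract_of M g f\<rbrakk> \<Longrightarrow> g \<in> Fib M"
    and Weq_retract: "\<lbrakk>f \<in> Weq M; retract_of M g f\<rbrakk> \<Longrightarrow> g \<in> Weq M"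
    and lift_Cof_TFib: "\<lbrakk>i \<in> Cof M; p \<in> TFib M\<rbrakk> \<Longrightarrow> has_lifting M i p"
    and lift_TCof_Fib: "\<lbrakk>i \<in> TCof M; p \<in> Fib M\<rbrakk> \<Longrightarrow> has_lifting M i p"
    and factor_Cof_TFib: "f \<in> Ar M
      \<Longrightarrow> \<exists>i\<in>Cof M. \<exists>p\<in>TFib M. Cod M i = Dom M p \<and> f = Comp M p i"
    and factor_TCof_Fib: "f \<in> Ar M
      \<Longrightarrow> \<exists>i\<in>TCof M. \<exists>p\<in>Fib M. Cod M i = Dom M p \<and> f = Comp M p i"

text \<open>
  Objects of \<open>M\<^sub>A\<close> are arrows out of \<open>A\<close>; an arrow from \<open>u\<close> to \<open>v\<close> is a triple \<open>(u, v, g)\<close>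
  with \<open>g u = v\<close>.
\<close>

definition under_cat :: "('o, 'm, 'x) cat_scheme \<Rightarrow> 'o \<Rightarrow> ('m, 'm \<times> 'm \<times> 'm) cat"
  where "under_cat K A =
    \<lparr>Ob = {u \<in> Ar K. Dom K u = A},
     Ar = {(u, v, g). u \<in> Ar K \<and> Dom K u = A \<and> v \<in> Ar K \<and> Dom K v = A \<and>
                      g \<in> Hom K (Cod K u) (Cod K v) \<and> Comp K g u = v},
     Dom = (\<lambda>(u, v, g). u),
     Cod = (\<lambda>(u, v, g). v),
     Id = (\<lambda>u. (u, u, Id K (Cod K u))),
     Comp = (\<lambda>(_, w, h) (u, _, g). (u, w, Comp K h g))\<rparr>"

definition under_model :: "('o, 'm, 'x) model_cat_scheme \<Rightarrow> 'o \<Rightarrow> ('m, 'm \<times> 'm \<times> 'm) model_cat"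
  where "under_model M A =
    cat.extend (under_cat M A)
      (model_cat.fields
        {(u, v, g) \<in> Ar (under_cat M A). g \<in> Cof M}
        {(u, v, g) \<in> Ar (under_cat M A). g \<in> Fib M}
        {(u, v, g) \<in> Ar (under_cat M A). g \<in> Weq M})"

text \<open>For \<open>f : A \<rightarrow> B\<close>, the functor from \<open>M\<^sub>A\<close> to \<open>M\<^sub>B\<close> given by push-out along \<open>f\<close>.\<close>

definition pushout_functor ::
    "('o, 'm, 'x) cat_scheme \<Rightarrow> 'm \<Rightarrow> ('m, 'm \<times> 'm \<times> 'm, 'm, 'm \<times> 'm \<times> 'm) fnctr"
  where "pushout_functor K f =
    \<lparr>FOb = (\<lambda>u. fst (pushout K f u)),
     FAr = (\<lambda>(u, v, g). (fst (pushout K f u), fst (pushout K f v),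
       pushout_desc K f u (fst (pushout K f v)) (Comp K (snd (pushout K f v)) g)))\<rparr>"

definition preserves_pullbacks_of_TFib ::
    "('o, 'm, 'x) model_cat_scheme \<Rightarrow> ('p, 'n, 'y) model_cat_scheme \<Rightarrow>
      ('o, 'm, 'p, 'n) fnctr \<Rightarrow> bool"
  where "preserves_pullbacks_of_TFib K L F \<longleftrightarrow>
    (\<forall>p\<in>TFib K. FAr F p \<in> TFib L) \<and>
    (\<forall>p q r s. p \<in> TFib K \<and> is_pullback K p q r s \<longrightarrow>
      is_pullback L (FAr F p) (FAr F q) (FAr F r) (FAr F s))"

definition flat :: "('o, 'm, 'x) model_cat_scheme \<Rightarrow> 'm \<Rightarrow> bool"
  where "flat M f \<longleftrightarrow> f \<in> Ar M \<and>
    preserves_pullbacks_of_TFib (under_model M (Dom M f)) (under_model M (Cod M f))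
      (pushout_functor M f)"

text \<open>
  Only the model-categorical data are an argument here; that they satisfy the axioms is a
  separate assumption, \<open>model_category\<close>.
\<close>

definition strong_left_proper :: "('o, 'm, 'x) model_cat_scheme \<Rightarrow> bool"
  where "strong_left_proper M \<longleftrightarrow> (\<forall>f\<in>Cof M. flat M f)"

locale direct_reedy = category C
  for C :: "('u, 'v, 'x) cat_scheme" +
  fixes deg :: "'u \<Rightarrow> nat"
  assumes nonempty: "Ob C \<noteq> {}"
    and raises_degree: "\<lbrakk>f \<in> Ar C; f \<noteq> Id C (Dom C f)\<rbrakk> \<Longrightarrow> deg (Dom C f) < deg (Cod C f)"

text \<open>
  The category \<open>[C, a)\<close>: an arrow from \<open>f : b \<rightarrow> a\<close> to \<open>g : c \<rightarrow> a\<close> is a triple \<open>(f, g, h)\<close>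
  with \<open>h : b \<rightarrow> c\<close> and \<open>g h = f\<close>.
\<close>

definition latching_cat :: "('u, 'v, 'x) cat_scheme \<Rightarrow> 'u \<Rightarrow> ('v, 'v \<times> 'v \<times> 'v) cat"
  where "latching_cat C a = (let N = {f \<in> Ar C. Cod C f = a \<and> f \<noteq> Id C a} in
    \<lparr>Ob = N,
     Ar = {(f, g, h). f \<in> N \<and> g \<in> N \<and> h \<in> Hom C (Dom C f) (Dom C g) \<and> Comp C g h = f},
     Dom = (\<lambda>(f, g, h). f),
     Cod = (\<lambda>(f, g, h). g),
     Id = (\<lambda>f. (f, f, Id C (Dom C f))),
     Comp = (\<lambda>(_, k, h') (f, _, h). (f, k, Comp C h' h))\<rparr>)"

definition latching_diagram ::
    "('u, 'v, 'x) cat_scheme \<Rightarrow> ('u, 'v, 'o, 'm) fnctr \<Rightarrow> ('v, 'v \<times> 'v \<times> 'v, 'o, 'm) fnctr"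
  where "latching_diagram C X =
    \<lparr>FOb = (\<lambda>f. FOb X (Dom C f)), FAr = (\<lambda>(f, g, h). FAr X h)\<rparr>"

definition latching_obj ::
    "('u, 'v, 'x) cat_scheme \<Rightarrow> ('o, 'm, 'y) cat_scheme \<Rightarrow> ('u, 'v, 'o, 'm) fnctr \<Rightarrow> 'u \<Rightarrow> 'o"
  where "latching_obj C M X a = fst (colim (latching_cat C a) M (latching_diagram C X))"

definition latching_inj ::
    "('u, 'v, 'x) cat_scheme \<Rightarrow> ('o, 'm, 'y) cat_scheme \<Rightarrow> ('u, 'v, 'o, 'm) fnctr \<Rightarrow> 'u \<Rightarrow> 'v \<Rightarrow> 'm"
  where "latching_inj C M X a = snd (colim (latching_cat C a) M (latching_diagram C X))"

text \<open>The map \<open>L\<^sub>a X \<rightarrow> X\<^sub>a\<close>, and the map \<open>L\<^sub>a X \<rightarrow> L\<^sub>a Y\<close> induced by \<open>t : X \<rightarrow> Y\<close>.\<close>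

definition latching_map ::
    "('u, 'v, 'x) cat_scheme \<Rightarrow> ('o, 'm, 'y) cat_scheme \<Rightarrow> ('u, 'v, 'o, 'm) fnctr \<Rightarrow> 'u \<Rightarrow> 'm"
  where "latching_map C M X a =
    (THE l. l \<in> Hom M (latching_obj C M X a) (FOb X a) \<and>
      (\<forall>f\<in>Ob (latching_cat C a). Comp M l (latching_inj C M X a f) = FAr X f))"

definition latching_nat ::
    "('u, 'v, 'x) cat_scheme \<Rightarrow> ('o, 'm, 'y) cat_scheme \<Rightarrow> ('u, 'v, 'o, 'm) nat_trans \<Rightarrow> 'u \<Rightarrow> 'm"
  where "latching_nat C M t a =
    (THE l. l \<in> Hom M (latching_obj C M (NDom t) a) (latching_obj C M (NCod t) a) \<and>
      (\<forall>f\<in>Ob (latching_cat C a). Comp M l (latching_inj C M (NDom t) a f) =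
        Comp M (latching_inj C M (NCod t) a f) (Cmp t (Dom C f))))"

text \<open>The map to \<open>Y\<^sub>a\<close> from the push-out of \<open>X\<^sub>a\<close> and \<open>L\<^sub>a Y\<close> under \<open>L\<^sub>a X\<close>.\<close>

definition relative_latching_map ::
    "('u, 'v, 'x) cat_scheme \<Rightarrow> ('o, 'm, 'y) cat_scheme \<Rightarrow> ('u, 'v, 'o, 'm) nat_trans \<Rightarrow> 'u \<Rightarrow> 'm"
  where "relative_latching_map C M t a =
    pushout_desc M (latching_map C M (NDom t) a) (latching_nat C M t a)
      (Cmp t a) (latching_map C M (NCod t) a)"

text \<open>
  The latching objects and push-outs in the definition of the cofibrations are chosen ones; since
  cofibrations of a model category are closed under composition with isomorphisms, the choice is
  immaterial.
\<close>

definition reedy ::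
    "('u, 'v, 'x) cat_scheme \<Rightarrow> ('o, 'm, 'y) model_cat_scheme \<Rightarrow>
      (('u, 'v, 'o, 'm) fnctr, ('u, 'v, 'o, 'm) nat_trans) model_cat"
  where "reedy C M =
    cat.extend (fun_cat C M)
      (model_cat.fields
        {t \<in> fun_arrows C M. \<forall>a\<in>Ob C. relative_latching_map C M t a \<in> Cof M}
        {t \<in> fun_arrows C M. \<forall>a\<in>Ob C. Cmp t a \<in> Fib M}
        {t \<in> fun_arrows C M. \<forall>a\<in>Ob C. Cmp t a \<in> Weq M})"

end

theory Submission
  imports Defs "HOL-Library.Countable"
begin

text \<open>
  Flatness of a map \<open>t : X \<rightarrow> Y\<close> of diagrams is an objectwise condition because everything in its
  definition is: trivial fibrations of diagrams are objectwise by definition, and push-outs and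
  pull-backs of diagrams are computed objectwise since \<open>M\<close> has them all
  (\<open>pointwise_if_pushout\<close>, \<open>pointwise_if_pullback\<close>, \<open>pullback_if_pointwise\<close>).  Pull-backs in an undercategory are
  pull-backs of the underlying maps (\<open>pullback_in_under_cat\<close>, \<open>pullback_if_under_cat\<close>).  Hence push-out
  along \<open>t\<close> takes a pull-back square of a trivial fibration to a square which at every object \<open>a\<close> is,
  up to isomorphism, the push-out of such a square along the flat map \<open>t\<^sub>a\<close>, and therefore a pull-back
  (\<open>flat_if_pointwise\<close>).  The isomorphism occurs because flatness is formulated with chosen push-outs,
  and it is absorbed once and for all by \<open>flat_TFib\<close> and \<open>flat_pullback\<close>.

  If \<open>M\<close> is strong left proper, it remains to see that a Reedy cofibration \<open>t\<close> is an objectwise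
  cofibration, for then each \<open>t\<^sub>a\<close> is flat.  In a model category it suffices that \<open>t\<^sub>a\<close> lifts
  against every trivial fibration (\<open>Cof_if_lifting\<close>), and such lifts are assembled by induction on
  the degree from lifts against the relative latching maps of \<open>t\<close> (\<open>pointwise_lifting\<close>).

  The constructions need push-outs, pull-backs and latching colimits in \<open>M\<close>.  Completeness and
  cocompleteness provide them because these shapes embed into the infinite type \<open>'u\<close>.  That
  pull-backs of diagrams exist and are objectwise follows from the same facts on push-outs, by
  reversing all arrows.
\<close>

section \<open>Opposite categories, isomorphisms and push-outs\<close>

text \<open>
  The record is updated, rather than rebuilt from its six fields, so that \<open>op_cat\<close> is an
  involution for records with further fields as well.
\<close>

definition op_cat :: "('o, 'm, 'x) cat_scheme \<Rightarrow> ('o, 'm, 'x) cat_scheme"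
  where "op_cat K = K\<lparr>Dom := Cod K, Cod := Dom K, Comp := \<lambda>g f. Comp K f g\<rparr>"

lemma op_cat_simps [simp]:
  "Ob (op_cat K) = Ob K" "Ar (op_cat K) = Ar K" "Dom (op_cat K) = Cod K" "Cod (op_cat K) = Dom K"
  "Id (op_cat K) = Id K" "Comp (op_cat K) g f = Comp K f g" "op_cat (op_cat K) = K"
  by (simp_all add: op_cat_def)

lemma Hom_op_cat [simp]: "Hom (op_cat K) x y = Hom K y x"
  by (auto simp: Hom_def)

lemma (in category) category_op_cat: "category (op_cat K)"
  by unfold_locales
    (simp_all add: Dom_Ob Cod_Ob Id_Ar Dom_Id Cod_Id Comp_Ar Dom_Comp Cod_Comp Comp_Id Id_Comp
      Comp_assoc)

lemma is_pushout_op_cat: "is_pushout (op_cat K) p q r s \<longleftrightarrow> is_pullback K p q r s"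
  unfolding is_pushout_def is_pullback_def by (auto simp: eq_commute)

lemma is_functor_op_cat: "is_functor (op_cat J) (op_cat K) D \<longleftrightarrow> is_functor J K D"
  by (auto simp: is_functor_def)

lemma is_colimit_op_cat: "is_colimit (op_cat J) (op_cat K) D L p \<longleftrightarrow> is_limit J K D L p"
  by (simp add: is_colimit_def is_limit_def is_cocone_def is_cone_def)

definition has_pushouts :: "('o, 'm, 'x) cat_scheme \<Rightarrow> bool"
  where "has_pushouts K \<longleftrightarrow>
    (\<forall>f\<in>Ar K. \<forall>u\<in>Ar K. Dom K f = Dom K u \<longrightarrow> (\<exists>i j. is_pushout K f u i j))"

definition has_pullbacks :: "('o, 'm, 'x) cat_scheme \<Rightarrow> bool"
  where "has_pullbacks K \<longleftrightarrow>
    (\<forall>p\<in>Ar K. \<forall>q\<in>Ar K. Cod K p = Cod K q \<longrightarrow> (\<exists>r s. is_pullback K p q r s))"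

lemma has_pushouts_op_cat: "has_pushouts (op_cat K) \<longleftrightarrow> has_pullbacks K"
  by (simp add: has_pushouts_def has_pullbacks_def is_pushout_op_cat)

context category
begin

lemmas cat_rules = Comp_Ar Dom_Comp Cod_Comp Comp_assoc

lemma Comp_Hom: "\<lbrakk>f \<in> Hom K x y; g \<in> Hom K y z\<rbrakk> \<Longrightarrow> Comp K g f \<in> Hom K x z"
  by (simp add: Hom_def cat_rules)

lemma Id_Hom: "x \<in> Ob K \<Longrightarrow> Id K x \<in> Hom K x x"
  by (simp add: Hom_def Id_Ar Dom_Id Cod_Id)

lemma Comp_Id_Hom: "f \<in> Hom K x y \<Longrightarrow> Comp K f (Id K x) = f"
  using Comp_Id by (auto simp: Hom_def)

lemma Id_Comp_Hom: "f \<in> Hom K x y \<Longrightarrow> Comp K (Id K y) f = f"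
  using Id_Comp by (auto simp: Hom_def)

lemma Hom_Ob: "f \<in> Hom K x y \<Longrightarrow> x \<in> Ob K \<and> y \<in> Ob K"
  using Dom_Ob Cod_Ob by (auto simp: Hom_def)

lemma assoc_Hom:
  "\<lbrakk>f \<in> Hom K w x; g \<in> Hom K x y; h \<in> Hom K y z\<rbrakk>
    \<Longrightarrow> Comp K (Comp K h g) f = Comp K h (Comp K g f)"
  using Comp_assoc by (auto simp: Hom_def)

definition inverse_arrows :: "'m \<Rightarrow> 'm \<Rightarrow> bool"
  where "inverse_arrows h k \<longleftrightarrow> h \<in> Ar K \<and> k \<in> Hom K (Cod K h) (Dom K h) \<and>
    Comp K k h = Id K (Dom K h) \<and> Comp K h k = Id K (Cod K h)"

lemma inverse_arrows_sym: "inverse_arrows h k \<Longrightarrow> inverse_arrows k h"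
  by (auto simp: inverse_arrows_def Hom_def)

lemma inverse_arrows_cancel:
  assumes "inverse_arrows h k"
  shows "\<lbrakk>f \<in> Ar K; Cod K f = Dom K h\<rbrakk> \<Longrightarrow> Comp K k (Comp K h f) = f"
    and "\<lbrakk>f \<in> Ar K; Dom K f = Cod K h\<rbrakk> \<Longrightarrow> Comp K (Comp K f h) k = f"
proof -
  assume "f \<in> Ar K" "Cod K f = Dom K h"
  with assms show "Comp K k (Comp K h f) = f"
    using Id_Comp[of f] by (simp add: inverse_arrows_def Hom_def flip: Comp_assoc)
next
  assume "f \<in> Ar K" "Dom K f = Cod K h"
  with assms show "Comp K (Comp K f h) k = f"
    using Comp_Id[of f] by (simp add: inverse_arrows_def Hom_def Comp_assoc)
qed

lemma is_pushoutI:
  assumes "f \<in> Hom K a b" "u \<in> Hom K a c" "i \<in> Hom K b p" "j \<in> Hom K c p"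
    and "Comp K i f = Comp K j u"
    and "\<And>d i' j'. \<lbrakk>i' \<in> Hom K b d; j' \<in> Hom K c d; Comp K i' f = Comp K j' u\<rbrakk>
      \<Longrightarrow> \<exists>h\<in>Hom K p d. Comp K h i = i' \<and> Comp K h j = j'"
    and "\<And>d h h'. \<lbrakk>h \<in> Hom K p d; h' \<in> Hom K p d; Comp K h i = Comp K h' i; Comp K h j = Comp K h' j\<rbrakk>
      \<Longrightarrow> h = h'"
  shows "is_pushout K f u i j"
  unfolding is_pushout_def
proof (intro conjI ballI impI)
  fix i' j' assume "i' \<in> Ar K" "j' \<in> Ar K" and *: "Cod K i' = Cod K j' \<and> Dom K i' = Cod K f \<and>
    Dom K j' = Cod K u \<and> Comp K i' f = Comp K j' u"
  then have "i' \<in> Hom K b (Cod K i')" "j' \<in> Hom K c (Cod K i')" "Comp K i' f = Comp K j' u"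
    using assms(1,2) by (auto simp: Hom_def)
  then obtain h where "h \<in> Hom K p (Cod K i')" "Comp K h i = i'" "Comp K h j = j'"
    using assms(6) by blast
  then show "\<exists>!h. h \<in> Hom K (Cod K i) (Cod K i') \<and> Comp K h i = i' \<and> Comp K h j = j'"
    using assms(3,7) by (intro ex1I[of _ h]) (auto simp: Hom_def)
qed (use assms(1-5) in \<open>auto simp: Hom_def\<close>)

lemma is_pushoutD:
  assumes "is_pushout K f u i j"
  shows "f \<in> Hom K (Dom K f) (Cod K f)" "u \<in> Hom K (Dom K f) (Cod K u)"
    "i \<in> Hom K (Cod K f) (Cod K i)" "j \<in> Hom K (Cod K u) (Cod K i)"
    "Comp K i f = Comp K j u"
  using assms by (auto simp: is_pushout_def Hom_def)

lemma is_pushout_universal: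
  assumes "is_pushout K f u i j" "i' \<in> Hom K (Cod K f) d" "j' \<in> Hom K (Cod K u) d"
    "Comp K i' f = Comp K j' u"
  shows "\<exists>!h. h \<in> Hom K (Cod K i) d \<and> Comp K h i = i' \<and> Comp K h j = j'"
proof -
  have ij: "i' \<in> Ar K" "j' \<in> Ar K" "Cod K i' = Cod K j'" "Dom K i' = Cod K f"
    "Dom K j' = Cod K u" and d: "d = Cod K i'"
    using assms(2,3) by (auto simp: Hom_def)
  have "\<forall>i'\<in>Ar K. \<forall>j'\<in>Ar K.
      Cod K i' = Cod K j' \<and> Dom K i' = Cod K f \<and> Dom K j' = Cod K u \<and>
      Comp K i' f = Comp K j' u \<longrightarrow>
      (\<exists>!h. h \<in> Hom K (Cod K i) (Cod K i') \<and> Comp K h i = i' \<and> Comp K h j = j')"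
    using assms(1) unfolding is_pushout_def by blast
  from this[rule_format, OF ij(1,2)] show ?thesis
    unfolding d using ij assms(4) by blast
qed

lemma is_pushout_ex:
  assumes "is_pushout K f u i j" "i' \<in> Hom K (Cod K f) d" "j' \<in> Hom K (Cod K u) d"
    "Comp K i' f = Comp K j' u"
  obtains h where "h \<in> Hom K (Cod K i) d" "Comp K h i = i'" "Comp K h j = j'"
  using is_pushout_universal[OF assms] that by blast

lemma is_pushout_eq:
  assumes "is_pushout K f u i j" "h \<in> Hom K (Cod K i) d" "h' \<in> Hom K (Cod K i) d"
    "Comp K h i = Comp K h' i" "Comp K h j = Comp K h' j"
  shows "h = h'"
proof -
  note po = is_pushoutD[OF assms(1)]
  have "Comp K h i \<in> Hom K (Cod K f) d" "Comp K h j \<in> Hom K (Cod K u) d"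
    using Comp_Hom[OF po(3) assms(2)] Comp_Hom[OF po(4) assms(2)] by simp_all
  moreover have "Comp K (Comp K h i) f = Comp K (Comp K h j) u"
    using assoc_Hom[OF po(1,3) assms(2)] assoc_Hom[OF po(2,4) assms(2)] po(5) by simp
  ultimately have ex: "\<exists>!k. k \<in> Hom K (Cod K i) d \<and> Comp K k i = Comp K h i \<and> Comp K k j = Comp K h j"
    by (rule is_pushout_universal[OF assms(1)])
  show ?thesis using the1_equality[OF ex, of h] the1_equality[OF ex, of h'] assms(2-5) by simp
qed

lemma pushout_comparison:
  assumes "is_pushout K f u i j" "is_pushout K f u i' j'"
  obtains h k where "inverse_arrows h k" "h \<in> Hom K (Cod K i) (Cod K i')"
    "Comp K h i = i'" "Comp K h j = j'"
proof -
  note po = is_pushoutD[OF assms(1)] and po' = is_pushoutD[OF assms(2)]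
  obtain h where h: "h \<in> Hom K (Cod K i) (Cod K i')" "Comp K h i = i'" "Comp K h j = j'"
    by (rule is_pushout_ex[OF assms(1) po'(3-5)])
  obtain k where k: "k \<in> Hom K (Cod K i') (Cod K i)" "Comp K k i' = i" "Comp K k j' = j"
    by (rule is_pushout_ex[OF assms(2) po(3-5)])
  have "Comp K k h = Id K (Cod K i)"
  proof (rule is_pushout_eq[OF assms(1)])
    show "Comp K k h \<in> Hom K (Cod K i) (Cod K i)" by (rule Comp_Hom[OF h(1) k(1)])
    show "Id K (Cod K i) \<in> Hom K (Cod K i) (Cod K i)" using Id_Hom Hom_Ob h(1) by blast
    show "Comp K (Comp K k h) i = Comp K (Id K (Cod K i)) i"
      using assoc_Hom[OF po(3) h(1) k(1)] h k Id_Comp_Hom[OF po(3)] by simp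
    show "Comp K (Comp K k h) j = Comp K (Id K (Cod K i)) j"
      using assoc_Hom[OF po(4) h(1) k(1)] h k Id_Comp_Hom[OF po(4)] by simp
  qed
  moreover have "Comp K h k = Id K (Cod K i')"
  proof (rule is_pushout_eq[OF assms(2)])
    show "Comp K h k \<in> Hom K (Cod K i') (Cod K i')" by (rule Comp_Hom[OF k(1) h(1)])
    show "Id K (Cod K i') \<in> Hom K (Cod K i') (Cod K i')" using Id_Hom Hom_Ob h(1) by blast
    show "Comp K (Comp K h k) i' = Comp K (Id K (Cod K i')) i'"
      using assoc_Hom[OF po'(3) k(1) h(1)] h k Id_Comp_Hom[OF po'(3)] by simp
    show "Comp K (Comp K h k) j' = Comp K (Id K (Cod K i')) j'"
      using assoc_Hom[OF po'(4) k(1) h(1)] h k Id_Comp_Hom[OF po'(4)] by simp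
  qed
  ultimately have "inverse_arrows h k"
    using h(1) k(1) by (auto simp: inverse_arrows_def Hom_def)
  then show thesis using that h by blast
qed

text \<open>
  For use with \<open>pushout_comparison\<close>: there \<open>h\<close> compares a push-out that was constructed explicitly
  with one that is only known by its universal property.
\<close>

lemma pushout_isomorphic:
  assumes po: "is_pushout K f u i j" and f: "inverse_arrows h k" and hD: "Dom K h = Cod K i"
  shows "is_pushout K f u (Comp K h i) (Comp K h j)"
proof -
  note p = is_pushoutD[OF po]
  have h: "h \<in> Hom K (Cod K i) (Cod K h)" and k: "k \<in> Hom K (Cod K h) (Cod K i)"
    using f hD by (auto simp: inverse_arrows_def Hom_def)
  show ?thesis
  proof (rule is_pushoutI[OF p(1,2) Comp_Hom[OF p(3) h] Comp_Hom[OF p(4) h]])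
    show "Comp K (Comp K h i) f = Comp K (Comp K h j) u"
      using p h assoc_Hom by metis
  next
    fix d i' j' assume ij: "i' \<in> Hom K (Cod K f) d" "j' \<in> Hom K (Cod K u) d" "Comp K i' f = Comp K j' u"
    obtain l where l: "l \<in> Hom K (Cod K i) d" "Comp K l i = i'" "Comp K l j = j'"
      by (rule is_pushout_ex[OF po ij])
    have kh: "Comp K k (Comp K h x) = x" if "x \<in> Hom K y (Cod K i)" for x y
      using inverse_arrows_cancel(1)[OF f] that hD by (auto simp: Hom_def)
    have "Comp K (Comp K l k) (Comp K h i) = i'"
      using assoc_Hom[OF Comp_Hom[OF p(3) h] k l(1)] kh[OF p(3)] l by simp
    moreover have "Comp K (Comp K l k) (Comp K h j) = j'"
      using assoc_Hom[OF Comp_Hom[OF p(4) h] k l(1)] kh[OF p(4)] l by simp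
    ultimately show "\<exists>l\<in>Hom K (Cod K h) d. Comp K l (Comp K h i) = i' \<and> Comp K l (Comp K h j) = j'"
      using Comp_Hom[OF k l(1)] by blast
  next
    fix d l l' assume l: "l \<in> Hom K (Cod K h) d" "l' \<in> Hom K (Cod K h) d"
      "Comp K l (Comp K h i) = Comp K l' (Comp K h i)" "Comp K l (Comp K h j) = Comp K l' (Comp K h j)"
    have hk: "Comp K (Comp K x h) k = x" if "x \<in> Hom K (Cod K h) y" for x y
      using inverse_arrows_cancel(2)[OF f] that by (auto simp: Hom_def)
    have "Comp K l h = Comp K l' h"
    proof (rule is_pushout_eq[OF po Comp_Hom[OF h l(1)] Comp_Hom[OF h l(2)]])
      show "Comp K (Comp K l h) i = Comp K (Comp K l' h) i"
        using assoc_Hom[OF p(3) h l(1)] assoc_Hom[OF p(3) h l(2)] l(3) by simp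
      show "Comp K (Comp K l h) j = Comp K (Comp K l' h) j"
        using assoc_Hom[OF p(4) h l(1)] assoc_Hom[OF p(4) h l(2)] l(4) by simp
    qed
    then show "l = l'"
      using hk[OF l(1)] hk[OF l(2)] by metis
  qed
qed

end

text \<open>A pull-back is a push-out in the opposite category, so the facts above dualize.\<close>

context category
begin

interpretation op: category "op_cat K" by (rule category_op_cat)

lemma inverse_arrows_op: "op.inverse_arrows h k \<longleftrightarrow> inverse_arrows k h"
  unfolding op.inverse_arrows_def inverse_arrows_def by (auto simp: Hom_def)

lemmas is_pullbackI = op.is_pushoutI[unfolded is_pushout_op_cat Hom_op_cat op_cat_simps]
lemmas is_pullbackD = op.is_pushoutD[unfolded is_pushout_op_cat Hom_op_cat op_cat_simps]
lemmas is_pullback_ex = op.is_pushout_ex[unfolded is_pushout_op_cat Hom_op_cat op_cat_simps]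
lemmas is_pullback_eq = op.is_pushout_eq[unfolded is_pushout_op_cat Hom_op_cat op_cat_simps]
lemmas pullback_comparison =
  op.pushout_comparison[unfolded is_pushout_op_cat Hom_op_cat op_cat_simps inverse_arrows_op]
lemmas pullback_isomorphic =
  op.pushout_isomorphic[unfolded is_pushout_op_cat Hom_op_cat op_cat_simps inverse_arrows_op]

end

section \<open>Colimits of small shapes\<close>

text \<open>
  Relabelling the objects and arrows of \<open>J\<close> by their images in \<open>'u\<close> gives a small category with
  the same cocones.
\<close>

lemma has_small_colimits_shape:
  fixes J :: "('j, 'k) cat" and e :: "'j \<Rightarrow> 'u" and e' :: "'k \<Rightarrow> 'u"
  assumes small: "has_small_colimits TYPE('u) K"
    and J: "category J" and e: "inj_on e (Ob J)" and e': "inj_on e' (Ar J)"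
    and D: "is_functor J K D"
  shows "\<exists>L i. is_colimit J K D L i"
proof -
  interpret J: category J by fact
  define b where "b = inv_into (Ob J) e"
  define b' where "b' = inv_into (Ar J) e'"
  have be [simp]: "b (e x) = x" if "x \<in> Ob J" for x
    using that e by (simp add: b_def)
  have be' [simp]: "b' (e' f) = f" if "f \<in> Ar J" for f
    using that e' by (simp add: b'_def)
  define J' :: "('u, 'u) cat" where "J' = \<lparr>Ob = e ` Ob J, Ar = e' ` Ar J, Dom = \<lambda>f. e (Dom J (b' f)),
    Cod = \<lambda>f. e (Cod J (b' f)), Id = \<lambda>x. e' (Id J (b x)), Comp = \<lambda>g f. e' (Comp J (b' g) (b' f))\<rparr>"
  have e_eq [simp]: "e x = e y \<longleftrightarrow> x = y" if "x \<in> Ob J" "y \<in> Ob J" for x y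
    using e that by (auto dest: inj_onD)
  have J': "category J'"
    by unfold_locales
      (auto simp: J'_def J.Dom_Ob J.Cod_Ob J.Id_Ar J.Dom_Id J.Cod_Id J.cat_rules J.Comp_Id J.Id_Comp)
  define D' where "D' = \<lparr>FOb = \<lambda>x. FOb D (b x), FAr = \<lambda>f. FAr D (b' f)\<rparr>"
  have "is_functor J' K D'"
    using D unfolding is_functor_def
    by (auto simp: J'_def D'_def J.Dom_Ob J.Cod_Ob J.Id_Ar J.Comp_Ar)
  then obtain L i where L: "is_colimit J' K D' L i"
    using small J' unfolding has_small_colimits_def by blast
  have cocone: "is_cocone J K D X (\<lambda>x. c (e x))" if "is_cocone J' K D' X c" for X c
    using that unfolding is_cocone_def by (auto simp: J'_def D'_def J.Dom_Ob J.Cod_Ob)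
  have cocone': "is_cocone J' K D' X (\<lambda>x. c (b x))" if "is_cocone J K D X c" for X c
    using that unfolding is_cocone_def by (auto simp: J'_def D'_def J.Dom_Ob J.Cod_Ob)
  have "is_colimit J K D L (\<lambda>x. i (e x))"
    unfolding is_colimit_def
  proof (intro conjI allI impI)
    show "is_cocone J K D L (\<lambda>x. i (e x))" using L cocone by (auto simp: is_colimit_def)
    fix L' i' assume "is_cocone J K D L' i'"
    then have "\<exists>!h. h \<in> Hom K L L' \<and> (\<forall>j\<in>Ob J'. Comp K h (i j) = i' (b j))"
      using L cocone' unfolding is_colimit_def by blast
    moreover have "(\<forall>j\<in>Ob J'. Comp K h (i j) = i' (b j)) \<longleftrightarrow> (\<forall>j\<in>Ob J. Comp K h (i (e j)) = i' j)"
      for h by (auto simp: J'_def)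
    ultimately show "\<exists>!h. h \<in> Hom K L L' \<and> (\<forall>j\<in>Ob J. Comp K h (i (e j)) = i' j)"
      by simp
  qed
  then show ?thesis by blast
qed

text \<open>
  The shape \<open>1 \<leftarrow> 0 \<rightarrow> 2\<close>.  It is a preorder, so an arrow is encoded as the pair of its ends.
\<close>

definition span_cat :: "(nat, nat \<times> nat) cat"
  where "span_cat = \<lparr>Ob = {x. x \<le> 2}, Ar = {f. snd f \<le> 2 \<and> (fst f = snd f \<or> fst f = 0)},
    Dom = fst, Cod = snd, Id = \<lambda>x. (x, x), Comp = \<lambda>g f. (fst f, snd g)\<rparr>"

lemma category_span_cat: "category span_cat"
  by unfold_locales (simp_all add: span_cat_def, auto)

lemma span_cat_simps:
  "Ob span_cat = {0, 1, 2}" "Ar span_cat = {(0, 0), (1, 1), (2, 2), (0, 1), (0, 2)}"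
  "Dom span_cat = fst" "Cod span_cat = snd" "Id span_cat = (\<lambda>x. (x, x))"
  "Comp span_cat = (\<lambda>g f. (fst f, snd g))"
  by (auto simp: span_cat_def)

lemma ex_inj_countable: "\<exists>e :: 'j::countable \<Rightarrow> 'u::infinite. inj e"
proof -
  obtain g :: "nat \<Rightarrow> 'u" where "inj g"
    using infinite_countable_subset[OF infinite_UNIV] by blast
  then have "inj (g \<circ> to_nat)" by (simp add: inj_compose)
  then show ?thesis by blast
qed

text \<open>
  The arrows of a latching category are triples of arrows of \<open>C\<close>; an infinite set has as many
  triples as elements, so latching categories are small again.
\<close>

lemma ex_inj_triple: "\<exists>e :: 'u::infinite \<times> 'u \<times> 'u \<Rightarrow> 'u. inj e"
proof -
  have "(card_of (UNIV \<times> UNIV :: ('u \<times> 'u) set), card_of (UNIV :: 'u set)) \<in> ordIso"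
    by (rule card_of_Times_same_infinite[OF infinite_UNIV])
  from card_of_ordIso[THEN iffD2, OF this] obtain p :: "'u \<times> 'u \<Rightarrow> 'u"
    where "bij_betw p (UNIV \<times> UNIV) UNIV" by blast
  then have p: "p x = p y \<longleftrightarrow> x = y" for x y
    by (metis UNIV_Times_UNIV bij_betw_def inj_eq)
  then have "inj (\<lambda>(x, y, z). p (x, p (y, z)))"
    by (simp add: inj_def p)
  then show ?thesis by blast
qed

lemma has_pushouts_if_small_colimits:
  assumes "category K" and small: "has_small_colimits TYPE('u::infinite) K"
  shows "has_pushouts K"
  unfolding has_pushouts_def
proof (intro ballI impI)
  interpret category K by fact
  fix f u assume f: "f \<in> Ar K" and u: "u \<in> Ar K" and fu: "Dom K f = Dom K u"
  define D where "D = \<lparr>FOb = \<lambda>x::nat. if x = 0 then Dom K f else if x = 1 then Cod K f else Cod K u,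
    FAr = \<lambda>g. if g = (0::nat, 1::nat) then f else if g = (0, 2) then u
      else if g = (0, 0) then Id K (Dom K f) else if g = (1, 1) then Id K (Cod K f) else Id K (Cod K u)\<rparr>"
  have obs: "Dom K f \<in> Ob K" "Dom K u \<in> Ob K" "Cod K f \<in> Ob K" "Cod K u \<in> Ob K"
    using f u Dom_Ob Cod_Ob by auto
  have "is_functor span_cat K D"
    unfolding is_functor_def using f u fu obs Comp_Id[OF f] Comp_Id[OF u] Id_Comp[OF f] Id_Comp[OF u]
      Comp_Id[OF Id_Ar] Dom_Id
    by (auto simp: span_cat_simps D_def Hom_def Id_Ar Dom_Id Cod_Id)
  moreover obtain e :: "nat \<Rightarrow> 'u" and e' :: "nat \<times> nat \<Rightarrow> 'u" where "inj e" "inj e'"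
    using ex_inj_countable by metis
  ultimately obtain L c where L: "is_colimit span_cat K D L c"
    using has_small_colimits_shape[OF small category_span_cat] inj_on_subset[OF _ subset_UNIV]
    by metis
  have cocone_iff: "is_cocone span_cat K D X d \<longleftrightarrow> d 1 \<in> Hom K (Cod K f) X \<and> d 2 \<in> Hom K (Cod K u) X \<and>
      d 0 = Comp K (d 1) f \<and> d 0 = Comp K (d 2) u" (is "?l \<longleftrightarrow> ?r") for X d
  proof
    assume ?l then show ?r
      unfolding is_cocone_def by (auto simp: span_cat_simps D_def)
  next
    assume r: ?r
    then have "Comp K (d 1) f \<in> Hom K (Dom K f) X"
      using Comp_Hom[of f "Dom K f" "Cod K f" "d 1" X] f by (simp add: Hom_def)
    with r show ?l
      unfolding is_cocone_def using Hom_Ob[of "d 1"] Comp_Id_Hom[of "d 0"] Comp_Id_Hom[of "d 1"]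
        Comp_Id_Hom[of "d 2"]
      by (auto simp: span_cat_simps D_def)
  qed
  have c: "c 1 \<in> Hom K (Cod K f) L" "c 2 \<in> Hom K (Cod K u) L" "c 0 = Comp K (c 1) f"
    "Comp K (c 1) f = Comp K (c 2) u"
    using L cocone_iff[of L c] by (auto simp: is_colimit_def)
  have fH: "f \<in> Hom K (Dom K f) (Cod K f)" and uH: "u \<in> Hom K (Dom K f) (Cod K u)"
    using f u fu by (auto simp: Hom_def)
  have univ: "\<exists>!h. h \<in> Hom K L X \<and> Comp K h (c 1) = i' \<and> Comp K h (c 2) = j'"
    if ij: "i' \<in> Hom K (Cod K f) X" "j' \<in> Hom K (Cod K u) X" "Comp K i' f = Comp K j' u" for X i' j'
  proof -
    define d where "d = (\<lambda>x::nat. if x = 1 then i' else if x = 2 then j' else Comp K i' f)"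
    have "is_cocone span_cat K D X d"
      unfolding cocone_iff using ij by (simp add: d_def)
    then have "\<exists>!h. h \<in> Hom K L X \<and> (\<forall>x\<in>Ob span_cat. Comp K h (c x) = d x)"
      using L unfolding is_colimit_def by blast
    moreover have "(\<forall>x\<in>Ob span_cat. Comp K h (c x) = d x) \<longleftrightarrow> Comp K h (c 1) = i' \<and> Comp K h (c 2) = j'"
      if "h \<in> Hom K L X" for h
      using c(3) assoc_Hom[OF fH c(1) that] by (auto simp: span_cat_simps d_def)
    ultimately show ?thesis by (simp cong: conj_cong)
  qed
  have "is_pushout K f u (c 1) (c 2)"
  proof (rule is_pushoutI[OF fH uH c(1,2,4)])
    fix X i' j' assume "i' \<in> Hom K (Cod K f) X" "j' \<in> Hom K (Cod K u) X" "Comp K i' f = Comp K j' u"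
    from ex1_implies_ex[OF univ[OF this]]
    show "\<exists>h\<in>Hom K L X. Comp K h (c 1) = i' \<and> Comp K h (c 2) = j'" by blast
  next
    fix X h h' assume h: "h \<in> Hom K L X" "h' \<in> Hom K L X" "Comp K h (c 1) = Comp K h' (c 1)"
      "Comp K h (c 2) = Comp K h' (c 2)"
    have "Comp K (Comp K h (c 1)) f = Comp K (Comp K h (c 2)) u"
      using assoc_Hom[OF fH c(1) h(1)] assoc_Hom[OF uH c(2) h(1)] c(4) by simp
    note ex = univ[OF Comp_Hom[OF c(1) h(1)] Comp_Hom[OF c(2) h(1)] this]
    show "h = h'"
      using the1_equality[OF ex, of h] the1_equality[OF ex, of h'] h by simp
  qed
  then show "\<exists>i j. is_pushout K f u i j" by blast
qed

lemma has_small_colimits_op_cat: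
  assumes "has_small_limits U K"
  shows "has_small_colimits U (op_cat K)"
  unfolding has_small_colimits_def
proof (intro allI impI)
  fix J :: "('a, 'a) cat" and D assume J: "category J \<and> is_functor J (op_cat K) D"
  then have "is_functor (op_cat J) K D"
    using is_functor_op_cat[of J "op_cat K" D] by simp
  moreover have "category (op_cat J)"
    using J by (simp add: category.category_op_cat)
  ultimately obtain L p where "is_limit (op_cat J) K D L p"
    using assms unfolding has_small_limits_def by blast
  then show "\<exists>L i. is_colimit J (op_cat K) D L i"
    using is_colimit_op_cat[of "op_cat J" K] by auto
qed

lemma has_pullbacks_if_small_limits:
  assumes "category K" "has_small_limits TYPE('u::infinite) K"
  shows "has_pullbacks K"
  using has_pushouts_if_small_colimits[OF category.category_op_cat[OF assms(1)]
    has_small_colimits_op_cat[OF assms(2)]]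
  by (simp add: has_pushouts_op_cat)

section \<open>Push-outs and pull-backs of diagrams\<close>

lemma fun_cat_simps [simp]:
  "Ob (fun_cat C D) = fun_objects C D" "Ar (fun_cat C D) = fun_arrows C D"
  "Dom (fun_cat C D) = NDom" "Cod (fun_cat C D) = NCod"
  "NDom (Comp (fun_cat C D) t s) = NDom s" "NCod (Comp (fun_cat C D) t s) = NCod t"
  "Cmp (Comp (fun_cat C D) t s) = (\<lambda>a\<in>Ob C. Comp D (Cmp t a) (Cmp s a))"
  "NDom (Id (fun_cat C D) F) = F" "NCod (Id (fun_cat C D) F) = F"
  "Cmp (Id (fun_cat C D) F) = (\<lambda>a\<in>Ob C. Id D (FOb F a))"
  by (simp_all add: fun_cat_def)

lemma fun_arrow_eqI:
  fixes s t :: "('o, 'm, 'p, 'n) nat_trans"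
  assumes "t \<in> fun_arrows C D" "s \<in> fun_arrows C D" "NDom t = NDom s" "NCod t = NCod s"
    and "\<And>a. a \<in> Ob C \<Longrightarrow> Cmp t a = Cmp s a"
  shows "t = s"
proof -
  have "Cmp t = Cmp s"
    using assms by (intro extensionalityI[of _ "Ob C"]) (auto simp: fun_arrows_def)
  with assms show ?thesis by simp
qed

locale functor_category = dom: category C + cod: category D
  for C :: "('o, 'm, 'x) cat_scheme" and D :: "('p, 'n, 'y) cat_scheme"
begin

lemma fun_objectD:
  assumes "F \<in> fun_objects C D"
  shows "a \<in> Ob C \<Longrightarrow> FOb F a \<in> Ob D"
    and "f \<in> Ar C \<Longrightarrow> FAr F f \<in> Hom D (FOb F (Dom C f)) (FOb F (Cod C f))"
    and "a \<in> Ob C \<Longrightarrow> FAr F (Id C a) = Id D (FOb F a)"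
    and "\<lbrakk>f \<in> Ar C; g \<in> Ar C; Cod C f = Dom C g\<rbrakk>
      \<Longrightarrow> FAr F (Comp C g f) = Comp D (FAr F g) (FAr F f)"
  using assms unfolding fun_objects_def is_functor_def by auto

lemma fun_arrowD:
  assumes "t \<in> fun_arrows C D"
  shows "NDom t \<in> fun_objects C D" "NCod t \<in> fun_objects C D"
    and "a \<in> Ob C \<Longrightarrow> Cmp t a \<in> Hom D (FOb (NDom t) a) (FOb (NCod t) a)"
    and "f \<in> Ar C \<Longrightarrow> Comp D (Cmp t (Cod C f)) (FAr (NDom t) f) =
      Comp D (FAr (NCod t) f) (Cmp t (Dom C f))"
  using assms unfolding fun_arrows_def by auto

lemma Id_fun_arrow: "F \<in> fun_objects C D \<Longrightarrow> Id (fun_cat C D) F \<in> fun_arrows C D"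
  using fun_objectD(1)[of F] cod.Id_Hom cod.Comp_Id_Hom[OF fun_objectD(2)[of F]]
    cod.Id_Comp_Hom[OF fun_objectD(2)[of F]] dom.Dom_Ob dom.Cod_Ob
  unfolding fun_arrows_def fun_cat_def by auto

lemma Comp_fun_arrow:
  assumes s: "s \<in> fun_arrows C D" and t: "t \<in> fun_arrows C D" and st: "NCod s = NDom t"
  shows "Comp (fun_cat C D) t s \<in> fun_arrows C D"
proof -
  have "Comp D (Comp D (Cmp t (Cod C f)) (Cmp s (Cod C f))) (FAr (NDom s) f) =
      Comp D (FAr (NCod t) f) (Comp D (Cmp t (Dom C f)) (Cmp s (Dom C f)))" if f: "f \<in> Ar C" for f
  proof -
    note ob = dom.Dom_Ob[OF f] dom.Cod_Ob[OF f]
    note sD = fun_arrowD(3)[OF s ob(1)] and sC = fun_arrowD(3)[OF s ob(2)]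
    note tD = fun_arrowD(3)[OF t ob(1), folded st] and tC = fun_arrowD(3)[OF t ob(2), folded st]
    note F = fun_objectD(2)[OF fun_arrowD(1)[OF s] f] fun_objectD(2)[OF fun_arrowD(2)[OF s] f]
      fun_objectD(2)[OF fun_arrowD(2)[OF t] f]
    show ?thesis
      using cod.assoc_Hom[OF F(1) sC tC] cod.assoc_Hom[OF sD F(2) tC] cod.assoc_Hom[OF sD tD F(3)]
        fun_arrowD(4)[OF s f] fun_arrowD(4)[OF t f] st by simp
  qed
  then show ?thesis
    using s t st cod.Comp_Hom[OF fun_arrowD(3)[OF s] fun_arrowD(3)[OF t, folded st]] dom.Dom_Ob dom.Cod_Ob
    by (auto simp: fun_arrows_def)
qed

lemma category_fun_cat: "category (fun_cat C D)"
proof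
  fix t assume "t \<in> Ar (fun_cat C D)"
  then have t: "t \<in> fun_arrows C D" by simp
  show "Dom (fun_cat C D) t \<in> Ob (fun_cat C D)" "Cod (fun_cat C D) t \<in> Ob (fun_cat C D)"
    using fun_arrowD(1,2)[OF t] by simp_all
  show "Comp (fun_cat C D) t (Id (fun_cat C D) (Dom (fun_cat C D) t)) = t"
    using t fun_arrowD(1,2)[OF t] cod.Comp_Id_Hom[OF fun_arrowD(3)[OF t]]
    by (intro fun_arrow_eqI[of _ C D]) (auto intro!: Comp_fun_arrow Id_fun_arrow)
  show "Comp (fun_cat C D) (Id (fun_cat C D) (Cod (fun_cat C D) t)) t = t"
    using t fun_arrowD(1,2)[OF t] cod.Id_Comp_Hom[OF fun_arrowD(3)[OF t]]
    by (intro fun_arrow_eqI[of _ C D]) (auto intro!: Comp_fun_arrow Id_fun_arrow)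
next
  fix r s t assume *: "r \<in> Ar (fun_cat C D)" "s \<in> Ar (fun_cat C D)" "t \<in> Ar (fun_cat C D)"
    "Cod (fun_cat C D) r = Dom (fun_cat C D) s" "Cod (fun_cat C D) s = Dom (fun_cat C D) t"
  show "Comp (fun_cat C D) (Comp (fun_cat C D) t s) r = Comp (fun_cat C D) t (Comp (fun_cat C D) s r)"
  proof (rule fun_arrow_eqI[of _ C D])
    fix a assume a: "a \<in> Ob C"
    have "Cmp r a \<in> Hom D (FOb (NDom r) a) (FOb (NDom s) a)" "Cmp s a \<in> Hom D (FOb (NDom s) a) (FOb (NDom t) a)"
      "Cmp t a \<in> Hom D (FOb (NDom t) a) (FOb (NCod t) a)"
      using * fun_arrowD(3)[OF _ a, of r] fun_arrowD(3)[OF _ a, of s] fun_arrowD(3)[OF _ a, of t] by auto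
    from cod.assoc_Hom[OF this] show "Cmp (Comp (fun_cat C D) (Comp (fun_cat C D) t s) r) a =
        Cmp (Comp (fun_cat C D) t (Comp (fun_cat C D) s r)) a"
      using a by simp
  qed (use * in \<open>auto intro!: Comp_fun_arrow\<close>)
qed (auto intro!: Comp_fun_arrow Id_fun_arrow)

end

sublocale functor_category \<subseteq> fc: category "fun_cat C D"
  by (rule category_fun_cat)

context functor_category
begin

text \<open>
  The maps induced at the objects are natural, since maps out of a push-out are determined by their
  restrictions to the two corners.
\<close>

lemma pushout_if_pointwise:
  assumes arrs: "f \<in> fun_arrows C D" "u \<in> fun_arrows C D" "i \<in> fun_arrows C D" "j \<in> fun_arrows C D"
    and ends: "NDom f = NDom u" "NCod i = NCod j" "NDom i = NCod f" "NDom j = NCod u"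
    and pw: "\<And>a. a \<in> Ob C \<Longrightarrow> is_pushout D (Cmp f a) (Cmp u a) (Cmp i a) (Cmp j a)"
  shows "is_pushout (fun_cat C D) f u i j"
proof (rule fc.is_pushoutI)
  show "f \<in> Hom (fun_cat C D) (NDom f) (NCod f)" "u \<in> Hom (fun_cat C D) (NDom f) (NCod u)"
    "i \<in> Hom (fun_cat C D) (NCod f) (NCod i)" "j \<in> Hom (fun_cat C D) (NCod u) (NCod i)"
    using arrs ends by (auto simp: Hom_def)
  show "Comp (fun_cat C D) i f = Comp (fun_cat C D) j u"
    using arrs ends pw by (intro fun_arrow_eqI[of _ C D]) (auto intro!: Comp_fun_arrow simp: is_pushout_def)
next
  fix X i' j'
  assume "i' \<in> Hom (fun_cat C D) (NCod f) X" "j' \<in> Hom (fun_cat C D) (NCod u) X"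
    and eq: "Comp (fun_cat C D) i' f = Comp (fun_cat C D) j' u"
  then have i': "i' \<in> fun_arrows C D" "NDom i' = NCod f" "NCod i' = X"
    and j': "j' \<in> fun_arrows C D" "NDom j' = NCod u" "NCod j' = X"
    by (auto simp: Hom_def)
  have cods: "Cod D (Cmp f a) = FOb (NCod f) a" "Cod D (Cmp u a) = FOb (NCod u) a"
    "Cod D (Cmp i a) = FOb (NCod i) a" if "a \<in> Ob C" for a
    using fun_arrowD(3)[OF _ that] arrs by (auto simp: Hom_def)
  have "\<exists>h\<in>Hom D (FOb (NCod i) a) (FOb X a).
      Comp D h (Cmp i a) = Cmp i' a \<and> Comp D h (Cmp j a) = Cmp j' a" if a: "a \<in> Ob C" for a
  proof -
    have "Cmp i' a \<in> Hom D (Cod D (Cmp f a)) (FOb X a)" "Cmp j' a \<in> Hom D (Cod D (Cmp u a)) (FOb X a)"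
      using fun_arrowD(3)[OF i'(1) a] fun_arrowD(3)[OF j'(1) a] i' j' cods[OF a] by auto
    moreover have "Comp D (Cmp i' a) (Cmp f a) = Comp D (Cmp j' a) (Cmp u a)"
      using arg_cong[OF eq, of "\<lambda>t. Cmp t a"] a by simp
    ultimately show ?thesis
      using cod.is_pushout_ex[OF pw[OF a]] cods[OF a] by metis
  qed
  then obtain h where h: "\<And>a. a \<in> Ob C \<Longrightarrow> h a \<in> Hom D (FOb (NCod i) a) (FOb X a) \<and>
      Comp D (h a) (Cmp i a) = Cmp i' a \<and> Comp D (h a) (Cmp j a) = Cmp j' a"
    by metis
  define t where "t = \<lparr>NDom = NCod i, NCod = X, Cmp = (\<lambda>a\<in>Ob C. h a)\<rparr>"
  have X: "X \<in> fun_objects C D" and P: "NCod i \<in> fun_objects C D"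
    using fun_arrowD(2)[OF i'(1)] fun_arrowD(2)[OF arrs(3)] i' by auto
  have nat: "Comp D (h (Cod C g)) (FAr (NCod i) g) = Comp D (FAr X g) (h (Dom C g))"
    if g: "g \<in> Ar C" for g
  proof -
    note ob = dom.Dom_Ob[OF g] dom.Cod_Ob[OF g]
    note hD = h[OF ob(1), THEN conjunct1] and hC = h[OF ob(2), THEN conjunct1]
    note FX = fun_objectD(2)[OF X g] and FP = fun_objectD(2)[OF P g]
    have tri: "Comp D (Comp D (h (Cod C g)) (FAr (NCod i) g)) (Cmp k (Dom C g)) =
        Comp D (Comp D (FAr X g) (h (Dom C g))) (Cmp k (Dom C g))"
      if k: "k \<in> fun_arrows C D" "NCod k = NCod i" and k': "k' \<in> fun_arrows C D" "NCod k' = X"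
        "NDom k' = NDom k"
        and hk: "\<And>a. a \<in> Ob C \<Longrightarrow> Comp D (h a) (Cmp k a) = Cmp k' a" for k k'
    proof -
      note kD = fun_arrowD(3)[OF k(1) ob(1), unfolded k(2)] and kC = fun_arrowD(3)[OF k(1) ob(2), unfolded k(2)]
      note FK = fun_objectD(2)[OF fun_arrowD(1)[OF k(1)] g]
      show ?thesis
        using cod.assoc_Hom[OF kD FP hC] cod.assoc_Hom[OF kD hD FX] cod.assoc_Hom[OF FK kC hC]
          fun_arrowD(4)[OF k(1) g] fun_arrowD(4)[OF k'(1) g] k k' hk[OF ob(1)] hk[OF ob(2)] by simp
    qed
    show ?thesis
    proof (rule cod.is_pushout_eq[OF pw[OF ob(1)]])
      show "Comp D (h (Cod C g)) (FAr (NCod i) g) \<in> Hom D (Cod D (Cmp i (Dom C g))) (FOb X (Cod C g))"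
        "Comp D (FAr X g) (h (Dom C g)) \<in> Hom D (Cod D (Cmp i (Dom C g))) (FOb X (Cod C g))"
        using cod.Comp_Hom[OF FP hC] cod.Comp_Hom[OF hD FX] cods[OF ob(1)] by simp_all
    qed (use tri[of i i'] tri[of j j'] arrs i' j' ends h in simp_all)
  qed
  have t: "t \<in> fun_arrows C D"
    using X P h nat dom.Dom_Ob dom.Cod_Ob by (auto simp: fun_arrows_def t_def)
  have "Comp (fun_cat C D) t i = i'"
    using arrs i' h ends t by (intro fun_arrow_eqI[of _ C D]) (auto intro!: Comp_fun_arrow simp: t_def)
  moreover have "Comp (fun_cat C D) t j = j'"
    using arrs j' h ends t by (intro fun_arrow_eqI[of _ C D]) (auto intro!: Comp_fun_arrow simp: t_def)
  ultimately show "\<exists>h\<in>Hom (fun_cat C D) (NCod i) X.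
      Comp (fun_cat C D) h i = i' \<and> Comp (fun_cat C D) h j = j'"
    using t by (intro bexI[of _ t]) (auto simp: Hom_def t_def)
next
  fix X h h'
  assume h: "h \<in> Hom (fun_cat C D) (NCod i) X" "h' \<in> Hom (fun_cat C D) (NCod i) X"
    and eq: "Comp (fun_cat C D) h i = Comp (fun_cat C D) h' i" "Comp (fun_cat C D) h j = Comp (fun_cat C D) h' j"
  then have h': "h \<in> fun_arrows C D" "h' \<in> fun_arrows C D" "NDom h = NDom h'" "NCod h = NCod h'" "NDom h = NCod i"
    by (auto simp: Hom_def)
  show "h = h'"
  proof (rule fun_arrow_eqI[OF h'(1-4)])
    fix a assume a: "a \<in> Ob C"
    have "Cod D (Cmp i a) = FOb (NCod i) a"
      using fun_arrowD(3)[OF arrs(3) a] by (simp add: Hom_def)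
    then have "Cmp h a \<in> Hom D (Cod D (Cmp i a)) (FOb (NCod h) a)" "Cmp h' a \<in> Hom D (Cod D (Cmp i a)) (FOb (NCod h) a)"
      using fun_arrowD(3)[OF h'(1) a] fun_arrowD(3)[OF h'(2) a] h' by simp_all
    moreover have "Comp D (Cmp h a) (Cmp i a) = Comp D (Cmp h' a) (Cmp i a)"
      "Comp D (Cmp h a) (Cmp j a) = Comp D (Cmp h' a) (Cmp j a)"
      using arg_cong[OF eq(1), of "\<lambda>t. Cmp t a"] arg_cong[OF eq(2), of "\<lambda>t. Cmp t a"] a by simp_all
    ultimately show "Cmp h a = Cmp h' a"
      by (rule cod.is_pushout_eq[OF pw[OF a]])
  qed
qed

text \<open>
  The maps that the arrows of \<open>C\<close> induce between push-outs at the objects are functorial, since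
  maps out of a push-out are determined by their restrictions to the two corners.
\<close>

lemma pointwise_pushout_exists:
  assumes po: "has_pushouts D"
    and f: "f \<in> fun_arrows C D" and u: "u \<in> fun_arrows C D" and fu: "NDom f = NDom u"
  obtains i j where "i \<in> fun_arrows C D" "j \<in> fun_arrows C D" "NCod i = NCod j" "NDom i = NCod f"
    "NDom j = NCod u" "\<And>a. a \<in> Ob C \<Longrightarrow> is_pushout D (Cmp f a) (Cmp u a) (Cmp i a) (Cmp j a)"
proof -
  define Y Z where "Y = NCod f" and "Z = NCod u"
  have Y: "Y \<in> fun_objects C D" and Z: "Z \<in> fun_objects C D"
    using fun_arrowD(2)[OF f] fun_arrowD(2)[OF u] by (auto simp: Y_def Z_def)
  have "\<exists>i j. is_pushout D (Cmp f a) (Cmp u a) i j" if "a \<in> Ob C" for a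
    using po fun_arrowD(3)[OF f that] fun_arrowD(3)[OF u that] fu
    unfolding has_pushouts_def Hom_def by simp
  then obtain I J where IJ: "\<And>a. a \<in> Ob C \<Longrightarrow> is_pushout D (Cmp f a) (Cmp u a) (I a) (J a)"
    by metis
  define P where "P a = Cod D (I a)" for a
  have I: "I a \<in> Hom D (FOb Y a) (P a)" and J: "J a \<in> Hom D (FOb Z a) (P a)"
    and IfJu: "Comp D (I a) (Cmp f a) = Comp D (J a) (Cmp u a)"
    and cods: "Cod D (Cmp f a) = FOb Y a" "Cod D (Cmp u a) = FOb Z a" if "a \<in> Ob C" for a
    using cod.is_pushoutD[OF IJ[OF that]] fun_arrowD(3)[OF f that] fun_arrowD(3)[OF u that]
    by (auto simp: Hom_def Y_def Z_def P_def)
  have "\<exists>h. h \<in> Hom D (P (Dom C g)) (P (Cod C g)) \<and> Comp D h (I (Dom C g)) = Comp D (I (Cod C g)) (FAr Y g) \<and>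
      Comp D h (J (Dom C g)) = Comp D (J (Cod C g)) (FAr Z g)" if g: "g \<in> Ar C" for g
  proof -
    note ob = dom.Dom_Ob[OF g] dom.Cod_Ob[OF g]
    note FY = fun_objectD(2)[OF Y g] and FZ = fun_objectD(2)[OF Z g]
    note FX = fun_objectD(2)[OF fun_arrowD(1)[OF f] g]
    note fD = fun_arrowD(3)[OF f ob(1), folded Y_def] and uD = fun_arrowD(3)[OF u ob(1), folded fu Z_def]
    note fC = fun_arrowD(3)[OF f ob(2), folded Y_def] and uC = fun_arrowD(3)[OF u ob(2), folded fu Z_def]
    have "Comp D (Comp D (I (Cod C g)) (FAr Y g)) (Cmp f (Dom C g)) =
        Comp D (Comp D (J (Cod C g)) (FAr Z g)) (Cmp u (Dom C g))"
      using cod.assoc_Hom[OF fD FY I[OF ob(2)]] cod.assoc_Hom[OF uD FZ J[OF ob(2)]]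
        cod.assoc_Hom[OF FX fC I[OF ob(2)]] cod.assoc_Hom[OF FX uC J[OF ob(2)]]
        fun_arrowD(4)[OF f g] fun_arrowD(4)[OF u g] fu IfJu[OF ob(2)]
      by (simp add: Y_def Z_def)
    moreover have "Comp D (I (Cod C g)) (FAr Y g) \<in> Hom D (Cod D (Cmp f (Dom C g))) (P (Cod C g))"
      "Comp D (J (Cod C g)) (FAr Z g) \<in> Hom D (Cod D (Cmp u (Dom C g))) (P (Cod C g))"
      using cod.Comp_Hom[OF FY I[OF ob(2)]] cod.Comp_Hom[OF FZ J[OF ob(2)]] cods[OF ob(1)] by simp_all
    ultimately show ?thesis
      using cod.is_pushout_ex[OF IJ[OF ob(1)]] P_def by metis
  qed
  then obtain H where H: "\<And>g. g \<in> Ar C \<Longrightarrow> H g \<in> Hom D (P (Dom C g)) (P (Cod C g))"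
    and HI: "\<And>g. g \<in> Ar C \<Longrightarrow> Comp D (H g) (I (Dom C g)) = Comp D (I (Cod C g)) (FAr Y g)"
    and HJ: "\<And>g. g \<in> Ar C \<Longrightarrow> Comp D (H g) (J (Dom C g)) = Comp D (J (Cod C g)) (FAr Z g)"
    by metis
  have P_eq: "h = h'" if "a \<in> Ob C" "h \<in> Hom D (P a) x" "h' \<in> Hom D (P a) x"
    "Comp D h (I a) = Comp D h' (I a)" "Comp D h (J a) = Comp D h' (J a)" for a x h h'
    using cod.is_pushout_eq[OF IJ[OF that(1)]] that(2-5) unfolding P_def by blast
  have Pob: "P a \<in> Ob D" if "a \<in> Ob C" for a
    using cod.Hom_Ob[OF I[OF that]] by simp
  have H_Id: "H (Id C a) = Id D (P a)" if a: "a \<in> Ob C" for a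
  proof (rule P_eq[OF a])
    note ida = dom.Id_Ar[OF a]
    show "H (Id C a) \<in> Hom D (P a) (P a)" using H[OF ida] dom.Dom_Id[OF a] dom.Cod_Id[OF a] by simp
    show "Id D (P a) \<in> Hom D (P a) (P a)" using cod.Id_Hom[OF Pob[OF a]] .
    show "Comp D (H (Id C a)) (I a) = Comp D (Id D (P a)) (I a)"
      using HI[OF ida] dom.Dom_Id[OF a] dom.Cod_Id[OF a] fun_objectD(3)[OF Y a]
        cod.Comp_Id_Hom[OF I[OF a]] cod.Id_Comp_Hom[OF I[OF a]] by simp
    show "Comp D (H (Id C a)) (J a) = Comp D (Id D (P a)) (J a)"
      using HJ[OF ida] dom.Dom_Id[OF a] dom.Cod_Id[OF a] fun_objectD(3)[OF Z a]
        cod.Comp_Id_Hom[OF J[OF a]] cod.Id_Comp_Hom[OF J[OF a]] by simp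
  qed
  have H_Comp: "H (Comp C g k) = Comp D (H g) (H k)"
    if k: "k \<in> Ar C" and g: "g \<in> Ar C" and kg: "Cod C k = Dom C g" for g k
  proof (rule P_eq[OF dom.Dom_Ob[OF k]])
    note gk = dom.Comp_Ar[OF k g kg] and dgk = dom.Dom_Comp[OF k g kg] and cgk = dom.Cod_Comp[OF k g kg]
    note Hg = H[OF g, folded kg]
    show "H (Comp C g k) \<in> Hom D (P (Dom C k)) (P (Cod C g))" using H[OF gk] dgk cgk by simp
    show "Comp D (H g) (H k) \<in> Hom D (P (Dom C k)) (P (Cod C g))" using cod.Comp_Hom[OF H[OF k] Hg] .
    have tri: "Comp D (H (Comp C g k)) (T (Dom C k)) = Comp D (Comp D (H g) (H k)) (T (Dom C k))"
      if T: "\<And>a. a \<in> Ob C \<Longrightarrow> T a \<in> Hom D (FOb W a) (P a)" and W: "W \<in> fun_objects C D"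
        and HT: "\<And>g. g \<in> Ar C \<Longrightarrow> Comp D (H g) (T (Dom C g)) = Comp D (T (Cod C g)) (FAr W g)" for T W
    proof -
      note TD = T[OF dom.Dom_Ob[OF k]] and TC = T[OF dom.Cod_Ob[OF k]] and TE = T[OF dom.Cod_Ob[OF g]]
      note Wk = fun_objectD(2)[OF W k] and Wg = fun_objectD(2)[OF W g, folded kg]
      show ?thesis
        using cod.assoc_Hom[OF TD H[OF k] Hg] cod.assoc_Hom[OF Wk TC Hg] cod.assoc_Hom[OF Wk Wg TE]
          HT[OF gk] HT[OF g] HT[OF k] dgk cgk fun_objectD(4)[OF W k g kg] kg by simp
    qed
    show "Comp D (H (Comp C g k)) (I (Dom C k)) = Comp D (Comp D (H g) (H k)) (I (Dom C k))"
      using tri[OF I Y HI] .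
    show "Comp D (H (Comp C g k)) (J (Dom C k)) = Comp D (Comp D (H g) (H k)) (J (Dom C k))"
      using tri[OF J Z HJ] .
  qed
  define Q where "Q = \<lparr>FOb = restrict P (Ob C), FAr = restrict H (Ar C)\<rparr>"
  have Q: "Q \<in> fun_objects C D"
    unfolding fun_objects_def is_functor_def Q_def
    using Pob H H_Id H_Comp dom.Dom_Ob dom.Cod_Ob dom.Id_Ar dom.Comp_Ar by auto
  define i j where "i = \<lparr>NDom = Y, NCod = Q, Cmp = restrict I (Ob C)\<rparr>"
    and "j = \<lparr>NDom = Z, NCod = Q, Cmp = restrict J (Ob C)\<rparr>"
  have "i \<in> fun_arrows C D" "j \<in> fun_arrows C D"
    using Q Y Z I J HI HJ dom.Dom_Ob dom.Cod_Ob by (auto simp: fun_arrows_def i_def j_def Q_def)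
  then show thesis
    by (rule that) (simp_all add: i_def j_def Y_def Z_def IJ)
qed

lemma has_pushouts_fun_cat: "has_pushouts D \<Longrightarrow> has_pushouts (fun_cat C D)"
  unfolding has_pushouts_def[of "fun_cat C D"]
  using pointwise_pushout_exists pushout_if_pointwise by (metis fun_cat_simps(2,3))

text \<open>
  A push-out of diagrams is isomorphic to the one assembled from push-outs at the objects, and
  evaluation at an object preserves isomorphisms.
\<close>

lemma pointwise_if_pushout:
  assumes po: "has_pushouts D" and sq: "is_pushout (fun_cat C D) f u i j" and a: "a \<in> Ob C"
  shows "is_pushout D (Cmp f a) (Cmp u a) (Cmp i a) (Cmp j a)"
proof -
  have fu: "f \<in> fun_arrows C D" "u \<in> fun_arrows C D" "NDom f = NDom u"
    using sq by (auto simp: is_pushout_def)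
  obtain i' j' where ij': "i' \<in> fun_arrows C D" "j' \<in> fun_arrows C D" "NCod i' = NCod j'" "NDom i' = NCod f"
    "NDom j' = NCod u" and pw: "\<And>a. a \<in> Ob C \<Longrightarrow> is_pushout D (Cmp f a) (Cmp u a) (Cmp i' a) (Cmp j' a)"
    using pointwise_pushout_exists[OF po fu] by blast
  have "is_pushout (fun_cat C D) f u i' j'"
    using pushout_if_pointwise fu ij' pw by blast
  then obtain h k where hk: "fc.inverse_arrows h k" and h: "h \<in> Hom (fun_cat C D) (NCod i') (NCod i)"
    "Comp (fun_cat C D) h i' = i" "Comp (fun_cat C D) h j' = j"
    using fc.pushout_comparison[OF _ sq] by (metis fun_cat_simps(4))
  have ha: "Cmp h a \<in> Hom D (FOb (NCod i') a) (FOb (NCod i) a)"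
    using h(1) fun_arrowD(3)[of h a] a by (auto simp: Hom_def)
  have ka: "Cmp k a \<in> Hom D (FOb (NCod i) a) (FOb (NCod i') a)"
    using hk h(1) fun_arrowD(3)[of k a] a by (auto simp: Hom_def fc.inverse_arrows_def)
  have "Cmp (Comp (fun_cat C D) k h) a = Cmp (Id (fun_cat C D) (NCod i')) a"
    "Cmp (Comp (fun_cat C D) h k) a = Cmp (Id (fun_cat C D) (NCod i)) a"
    using hk h(1) by (simp_all add: fc.inverse_arrows_def Hom_def)
  then have "cod.inverse_arrows (Cmp h a) (Cmp k a)"
    using a ha ka by (simp add: cod.inverse_arrows_def Hom_def)
  moreover have "Dom D (Cmp h a) = Cod D (Cmp i' a)"
    using ha fun_arrowD(3)[OF ij'(1) a] by (simp add: Hom_def)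
  ultimately have "is_pushout D (Cmp f a) (Cmp u a) (Comp D (Cmp h a) (Cmp i' a)) (Comp D (Cmp h a) (Cmp j' a))"
    by (rule cod.pushout_isomorphic[OF pw[OF a]])
  then show ?thesis
    using arg_cong[OF h(2), of "\<lambda>t. Cmp t a"] arg_cong[OF h(3), of "\<lambda>t. Cmp t a"] a by simp
qed

end

text \<open>
  A transformation records its source and target, so the diagrams between the opposite categories
  form the opposite of the diagram category only after exchanging these two entries.  Under this
  identification the facts on push-outs of diagrams become facts on pull-backs.
\<close>

definition op_trans :: "('o, 'm, 'p, 'n) nat_trans \<Rightarrow> ('o, 'm, 'p, 'n) nat_trans"
  where "op_trans t = \<lparr>NDom = NCod t, NCod = NDom t, Cmp = Cmp t\<rparr>"

lemma op_trans_simps [simp]: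
  "NDom (op_trans t) = NCod t" "NCod (op_trans t) = NDom t" "Cmp (op_trans t) = Cmp t"
  "op_trans (op_trans t) = t"
  by (simp_all add: op_trans_def)

lemma fun_objects_op_cat: "fun_objects (op_cat C) (op_cat D) = fun_objects C D"
  by (simp add: fun_objects_def is_functor_op_cat)

lemma op_trans_fun_arrows: "op_trans t \<in> fun_arrows (op_cat C) (op_cat D) \<longleftrightarrow> t \<in> fun_arrows C D"
  by (auto simp: fun_arrows_def fun_objects_op_cat)

lemma fun_arrows_op_cat: "fun_arrows (op_cat C) (op_cat D) = op_trans ` fun_arrows C D"
proof (intro set_eqI iffI)
  fix t assume "t \<in> fun_arrows (op_cat C) (op_cat D)"
  then have "op_trans t \<in> fun_arrows C D"
    using op_trans_fun_arrows[of "op_trans t" C D] by simp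
  then have "op_trans (op_trans t) \<in> op_trans ` fun_arrows C D" by (rule imageI)
  then show "t \<in> op_trans ` fun_arrows C D" by simp
qed (auto simp: op_trans_fun_arrows)

lemma op_trans_Comp:
  "Comp (fun_cat (op_cat C) (op_cat D)) (op_trans s) (op_trans t) = op_trans (Comp (fun_cat C D) t s)"
  by (simp add: fun_cat_def op_trans_def)

lemma op_trans_eq_iff: "op_trans s = op_trans t \<longleftrightarrow> s = t"
  by (metis op_trans_simps(4))

lemma pushout_op_trans:
  "is_pushout (fun_cat (op_cat C) (op_cat D)) (op_trans p) (op_trans q) (op_trans r) (op_trans s) \<longleftrightarrow>
    is_pullback (fun_cat C D) p q r s"
proof -
  have hom: "h \<in> Hom (fun_cat (op_cat C) (op_cat D)) x y \<longleftrightarrow> op_trans h \<in> Hom (fun_cat C D) y x" for h x y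
    using op_trans_fun_arrows[of "op_trans h" C D] by (auto simp: Hom_def)
  have ex1: "(\<exists>!h. P (op_trans h)) \<longleftrightarrow> (\<exists>!h. P h)" for P
    by (metis op_trans_simps(4))
  have comp: "Comp (fun_cat (op_cat C) (op_cat D)) h (op_trans t) = op_trans (Comp (fun_cat C D) t (op_trans h))"
    for h t using op_trans_Comp[of C D "op_trans h" t] by simp
  show ?thesis
    unfolding is_pushout_def is_pullback_def
    by (simp add: op_trans_fun_arrows[unfolded fun_arrows_op_cat] fun_arrows_op_cat hom comp op_trans_eq_iff del: fun_cat_simps(5-7))
      (simp only: ex1[of "\<lambda>h. h \<in> Hom (fun_cat C D) _ _ \<and> Comp (fun_cat C D) r h = _ \<and> Comp (fun_cat C D) s h = _"])
qed

context functor_category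
begin

interpretation op: functor_category "op_cat C" "op_cat D"
  by (intro functor_category.intro dom.category_op_cat cod.category_op_cat)

lemma pullback_if_pointwise:
  assumes "p \<in> fun_arrows C D" "q \<in> fun_arrows C D" "r \<in> fun_arrows C D" "s \<in> fun_arrows C D"
    and "NCod p = NCod q" "NDom r = NDom s" "NCod r = NDom p" "NCod s = NDom q"
    and "\<And>a. a \<in> Ob C \<Longrightarrow> is_pullback D (Cmp p a) (Cmp q a) (Cmp r a) (Cmp s a)"
  shows "is_pullback (fun_cat C D) p q r s"
  using op.pushout_if_pointwise[of "op_trans p" "op_trans q" "op_trans r" "op_trans s"] assms
  by (simp add: op_trans_fun_arrows pushout_op_trans is_pushout_op_cat)

lemma pointwise_if_pullback:
  assumes "has_pullbacks D" "is_pullback (fun_cat C D) p q r s" "a \<in> Ob C"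
  shows "is_pullback D (Cmp p a) (Cmp q a) (Cmp r a) (Cmp s a)"
  using op.pointwise_if_pushout[of "op_trans p" "op_trans q" "op_trans r" "op_trans s" a] assms
  by (simp add: has_pushouts_op_cat pushout_op_trans is_pushout_op_cat)

lemma has_pullbacks_fun_cat:
  assumes "has_pullbacks D"
  shows "has_pullbacks (fun_cat C D)"
  unfolding has_pullbacks_def
proof (intro ballI impI)
  fix p q assume pq: "p \<in> Ar (fun_cat C D)" "q \<in> Ar (fun_cat C D)" "Cod (fun_cat C D) p = Cod (fun_cat C D) q"
  then obtain i j where "is_pushout (fun_cat (op_cat C) (op_cat D)) (op_trans p) (op_trans q) i j"
    using op.has_pushouts_fun_cat assms op_trans_fun_arrows
    unfolding has_pushouts_op_cat has_pushouts_def[of "fun_cat _ _"]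
    by (metis fun_cat_simps(2-4) op_trans_simps(1))
  then show "\<exists>r s. is_pullback (fun_cat C D) p q r s"
    by (metis op_trans_simps(4) pushout_op_trans)
qed

end

section \<open>Pull-backs in undercategories\<close>

lemma under_cat_simps [simp]:
  "u \<in> Ob (under_cat K A) \<longleftrightarrow> u \<in> Ar K \<and> Dom K u = A"
  "(u, v, g) \<in> Ar (under_cat K A) \<longleftrightarrow> u \<in> Ar K \<and> Dom K u = A \<and> v \<in> Ar K \<and> Dom K v = A \<and>
    g \<in> Hom K (Cod K u) (Cod K v) \<and> Comp K g u = v"
  "Dom (under_cat K A) (u, v, g) = u"
  "Cod (under_cat K A) (u, v, g) = v"
  "Id (under_cat K A) u = (u, u, Id K (Cod K u))"
  "Comp (under_cat K A) (v', w, h) (u, v, g) = (u, w, Comp K h g)"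
  by (auto simp: under_cat_def)

context category
begin

lemma category_under_cat: "category (under_cat K A)"
proof
  fix f g h assume "f \<in> Ar (under_cat K A)" "g \<in> Ar (under_cat K A)" "h \<in> Ar (under_cat K A)"
    "Cod (under_cat K A) f = Dom (under_cat K A) g" "Cod (under_cat K A) g = Dom (under_cat K A) h"
  then show "Comp (under_cat K A) (Comp (under_cat K A) h g) f =
      Comp (under_cat K A) h (Comp (under_cat K A) g f)"
    by (cases f; cases g; cases h) (auto simp: assoc_Hom)
next
  fix f g assume *: "f \<in> Ar (under_cat K A)" "g \<in> Ar (under_cat K A)"
    "Cod (under_cat K A) f = Dom (under_cat K A) g"
  obtain u v w k l where fg: "f = (u, v, k)" "g = (v, w, l)"
    using * by (cases f; cases g) auto
  have "u \<in> Hom K A (Cod K u)" "k \<in> Hom K (Cod K u) (Cod K v)" "l \<in> Hom K (Cod K v) (Cod K w)"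
    using * fg by (auto simp: Hom_def)
  from assoc_Hom[OF this] Comp_Hom[OF this(2,3)] * fg
  show "Comp (under_cat K A) g f \<in> Ar (under_cat K A)"
    "Dom (under_cat K A) (Comp (under_cat K A) g f) = Dom (under_cat K A) f"
    "Cod (under_cat K A) (Comp (under_cat K A) g f) = Cod (under_cat K A) g"
    by auto
next
  fix f assume "f \<in> Ar (under_cat K A)"
  then show "Dom (under_cat K A) f \<in> Ob (under_cat K A)" "Cod (under_cat K A) f \<in> Ob (under_cat K A)"
    "Comp (under_cat K A) f (Id (under_cat K A) (Dom (under_cat K A) f)) = f"
    "Comp (under_cat K A) (Id (under_cat K A) (Cod (under_cat K A) f)) f = f"
    by (cases f; auto simp: Comp_Id_Hom Id_Comp_Hom)+
qed (auto simp: Id_Hom Cod_Ob Id_Comp)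

lemma under_arrowE:
  assumes "t \<in> Hom (under_cat K A) u v"
  obtains g where "t = (u, v, g)" "u \<in> Hom K A (Cod K u)" "v \<in> Hom K A (Cod K v)"
    "g \<in> Hom K (Cod K u) (Cod K v)" "Comp K g u = v"
proof -
  obtain u' v' g where t: "t = (u', v', g)" by (cases t)
  with assms have "u' = u" "v' = v" by (auto simp: Hom_def)
  with t assms that show thesis by (auto simp: Hom_def)
qed

lemma under_arrowI:
  "\<lbrakk>u \<in> Hom K A x; v \<in> Hom K A y; g \<in> Hom K x y; Comp K g u = v\<rbrakk>
    \<Longrightarrow> (u, v, g) \<in> Hom (under_cat K A) u v"
  by (auto simp: Hom_def)

text \<open>
  A map into the pull-back that is induced by maps under \<open>A\<close> is itself under \<open>A\<close>, because this can
  be tested after composing with the two projections.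
\<close>

lemma pullback_in_under_cat:
  assumes pb: "is_pullback K p q r s"
    and p: "(c, d, p) \<in> Ar (under_cat K A)" and q: "(e, d, q) \<in> Ar (under_cat K A)"
    and r: "(x, c, r) \<in> Ar (under_cat K A)" and s: "(x, e, s) \<in> Ar (under_cat K A)"
  shows "is_pullback (under_cat K A) (c, d, p) (e, d, q) (x, c, r) (x, e, s)"
proof -
  interpret un: category "under_cat K A" by (rule category_under_cat)
  have h: "p \<in> Hom K (Cod K c) (Cod K d)" "q \<in> Hom K (Cod K e) (Cod K d)"
    "r \<in> Hom K (Cod K x) (Cod K c)" "s \<in> Hom K (Cod K x) (Cod K e)"
    and u: "c \<in> Hom K A (Cod K c)" "d \<in> Hom K A (Cod K d)" "e \<in> Hom K A (Cod K e)" "x \<in> Hom K A (Cod K x)"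
    using p q r s by (auto simp: Hom_def)
  have ends: "Dom K p = Cod K c" "Dom K q = Cod K e" "Dom K r = Cod K x"
    using h by (auto simp: Hom_def)
  show ?thesis
  proof (rule un.is_pullbackI)
    show "(c, d, p) \<in> Hom (under_cat K A) c d" "(e, d, q) \<in> Hom (under_cat K A) e d"
      "(x, c, r) \<in> Hom (under_cat K A) x c" "(x, e, s) \<in> Hom (under_cat K A) x e"
      using p q r s by (simp_all add: Hom_def)
    show "Comp (under_cat K A) (c, d, p) (x, c, r) = Comp (under_cat K A) (e, d, q) (x, e, s)"
      using is_pullbackD(5)[OF pb] by simp
  next
    fix y r' s'
    assume r's': "r' \<in> Hom (under_cat K A) y c" "s' \<in> Hom (under_cat K A) y e"
      "Comp (under_cat K A) (c, d, p) r' = Comp (under_cat K A) (e, d, q) s'"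
    obtain k where k: "r' = (y, c, k)" "k \<in> Hom K (Cod K y) (Cod K c)" "Comp K k y = c" "y \<in> Hom K A (Cod K y)"
      using under_arrowE[OF r's'(1)] by metis
    obtain l where l: "s' = (y, e, l)" "l \<in> Hom K (Cod K y) (Cod K e)" "Comp K l y = e"
      using under_arrowE[OF r's'(2)] by metis
    have "Comp K p k = Comp K q l" using r's'(3) k l by simp
    then obtain h where hh: "h \<in> Hom K (Cod K y) (Cod K x)" "Comp K r h = k" "Comp K s h = l"
      using is_pullback_ex[OF pb, of k "Cod K y" l] k(2) l(2) ends by metis
    have "Comp K h y = x"
    proof (rule is_pullback_eq[OF pb])
      show "Comp K h y \<in> Hom K A (Dom K r)" "x \<in> Hom K A (Dom K r)"
        using Comp_Hom[OF k(4) hh(1)] u(4) ends by simp_all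
      show "Comp K r (Comp K h y) = Comp K r x" "Comp K s (Comp K h y) = Comp K s x"
        using assoc_Hom[OF k(4) hh(1) h(3)] assoc_Hom[OF k(4) hh(1) h(4)] hh k l r s by auto
    qed
    then have "(y, x, h) \<in> Hom (under_cat K A) y x"
      using under_arrowI k(4) u(4) hh(1) by blast
    then show "\<exists>h\<in>Hom (under_cat K A) y x. Comp (under_cat K A) (x, c, r) h = r' \<and>
        Comp (under_cat K A) (x, e, s) h = s'"
      using hh k l by (intro bexI[of _ "(y, x, h)"]) simp_all
  next
    fix y h h'
    assume hh: "h \<in> Hom (under_cat K A) y x" "h' \<in> Hom (under_cat K A) y x"
      "Comp (under_cat K A) (x, c, r) h = Comp (under_cat K A) (x, c, r) h'"
      "Comp (under_cat K A) (x, e, s) h = Comp (under_cat K A) (x, e, s) h'"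
    obtain k where k: "h = (y, x, k)" "k \<in> Hom K (Cod K y) (Dom K r)"
      using under_arrowE[OF hh(1)] ends by metis
    obtain l where l: "h' = (y, x, l)" "l \<in> Hom K (Cod K y) (Dom K r)"
      using under_arrowE[OF hh(2)] ends by metis
    have "k = l"
      by (rule is_pullback_eq[OF pb k(2) l(2)]) (use hh k l in simp_all)
    then show "h = h'" using k l by simp
  qed
qed

lemma under_pullbackE:
  assumes "is_pullback (under_cat K A) P Q R S"
  obtains c d e x p q r s where "P = (c, d, p)" "Q = (e, d, q)" "R = (x, c, r)" "S = (x, e, s)"
    "(c, d, p) \<in> Ar (under_cat K A)" "(e, d, q) \<in> Ar (under_cat K A)"
    "(x, c, r) \<in> Ar (under_cat K A)" "(x, e, s) \<in> Ar (under_cat K A)"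
proof -
  obtain c d p e d' q x c' r x' e' s
    where t: "P = (c, d, p)" "Q = (e, d', q)" "R = (x, c', r)" "S = (x', e', s)"
    by (cases P; cases Q; cases R; cases S)
  with assms have "d' = d" "c' = c" "x' = x" "e' = e"
    by (simp_all add: is_pullback_def)
  moreover have "P \<in> Ar (under_cat K A)" "Q \<in> Ar (under_cat K A)" "R \<in> Ar (under_cat K A)" "S \<in> Ar (under_cat K A)"
    using assms by (simp_all add: is_pullback_def)
  ultimately show thesis using t that by blast
qed

text \<open>
  The pull-back of the underlying maps lies under \<open>A\<close> by its universal property, so it is also
  the pull-back in the undercategory.
\<close>

lemma pullback_if_under_cat:
  assumes has: "has_pullbacks K"
    and pb: "is_pullback (under_cat K A) (c, d, p) (e, d, q) (x, c, r) (x, e, s)"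
  shows "is_pullback K p q r s"
proof -
  interpret un: category "under_cat K A" by (rule category_under_cat)
  have ars: "(c, d, p) \<in> Ar (under_cat K A)" "(e, d, q) \<in> Ar (under_cat K A)"
    using pb unfolding is_pullback_def by blast+
  then have h: "p \<in> Hom K (Cod K c) (Cod K d)" "q \<in> Hom K (Cod K e) (Cod K d)"
    and u: "c \<in> Hom K A (Cod K c)" "d \<in> Hom K A (Cod K d)" "e \<in> Hom K A (Cod K e)"
    and com: "Comp K p c = d" "Comp K q e = d"
    by (auto simp: Hom_def)
  have ends: "Dom K p = Cod K c" "Dom K q = Cod K e"
    using h by (auto simp: Hom_def)
  obtain r' s' where pb': "is_pullback K p q r' s'"
    using has h unfolding has_pullbacks_def Hom_def by force
  obtain y where y: "y \<in> Hom K A (Dom K r')" "Comp K r' y = c" "Comp K s' y = e"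
    using is_pullback_ex[OF pb', of c A e] u com ends by metis
  have Cy: "Cod K y = Dom K r'" using y(1) by (simp add: Hom_def)
  have "(y, c, r') \<in> Hom (under_cat K A) y c" "(y, e, s') \<in> Hom (under_cat K A) y e"
    using is_pullbackD(3,4)[OF pb'] y u ends by (auto intro!: under_arrowI)
  then have pb'': "is_pullback (under_cat K A) (c, d, p) (e, d, q) (y, c, r') (y, e, s')"
    using pullback_in_under_cat[OF pb' ars] by (simp add: Hom_def)
  obtain H L where HL: "un.inverse_arrows L H" "H \<in> Hom (under_cat K A) x y"
    "Comp (under_cat K A) (y, c, r') H = (x, c, r)" "Comp (under_cat K A) (y, e, s') H = (x, e, s)"
    using un.pullback_comparison[OF pb'' pb] by (metis under_cat_simps(3))
  obtain h where hh: "H = (x, y, h)" "h \<in> Hom K (Cod K x) (Cod K y)"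
    using under_arrowE[OF HL(2)] by metis
  have "L \<in> Hom (under_cat K A) y x"
    using un.inverse_arrows_sym[OF HL(1)] hh by (auto simp: un.inverse_arrows_def)
  then obtain l where l: "L = (y, x, l)" "l \<in> Hom K (Cod K y) (Cod K x)"
    using under_arrowE by metis
  have "inverse_arrows l h"
    using HL(1) hh l by (auto simp: inverse_arrows_def un.inverse_arrows_def Hom_def)
  then have "is_pullback K p q (Comp K r' h) (Comp K s' h)"
    by (rule pullback_isomorphic[OF pb']) (use hh Cy in \<open>simp add: Hom_def\<close>)
  then show ?thesis using HL hh by simp
qed

text \<open>
  The pull-back squares that flatness produces have chosen push-outs as vertices; isomorphisms of
  squares carry them to squares on any other push-outs.
\<close>

lemma pullback_square_isomorphic:
  assumes pb: "is_pullback K p q r s"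
    and p': "p' \<in> Hom K c' d'" and q': "q' \<in> Hom K e' d'" and r': "r' \<in> Hom K x' c'" and s': "s' \<in> Hom K x' e'"
    and c: "inverse_arrows tc tc'" "tc \<in> Hom K (Dom K p) c'" and d: "inverse_arrows td td'" "td \<in> Hom K (Cod K p) d'"
    and e: "inverse_arrows te te'" "te \<in> Hom K (Dom K q) e'" and x: "inverse_arrows tx tx'" "tx \<in> Hom K (Dom K r) x'"
    and com: "Comp K p' tc = Comp K td p" "Comp K q' te = Comp K td q"
      "Comp K r' tx = Comp K tc r" "Comp K s' tx = Comp K te s"
  shows "is_pullback K p' q' r' s'"
proof -
  note P = is_pullbackD[OF pb]
  have c': "tc' \<in> Hom K c' (Dom K p)" and d': "td' \<in> Hom K d' (Cod K p)"
    and e': "te' \<in> Hom K e' (Dom K q)" and x': "tx' \<in> Hom K x' (Dom K r)"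
    using c d e x by (auto simp: inverse_arrows_def Hom_def)
  have canc: "Comp K k (Comp K h f) = f" if "inverse_arrows h k" "h \<in> Hom K y z" "f \<in> Hom K w y" for h k f w y z
    using inverse_arrows_cancel(1)[OF that(1), of f] that(2,3) by (auto simp: Hom_def)
  have canc': "Comp K h (Comp K k f) = f" if "inverse_arrows h k" "h \<in> Hom K y z" "f \<in> Hom K w z" for h k f w y z
    using inverse_arrows_cancel(1)[OF inverse_arrows_sym[OF that(1)], of f] that
    by (auto simp: inverse_arrows_def Hom_def)
  have cancr: "f = g" if "inverse_arrows h k" "h \<in> Hom K y z" "f \<in> Hom K z w" "g \<in> Hom K z w"
    "Comp K f h = Comp K g h" for h k f g w y z
  proof -
    have "Comp K (Comp K f h) k = f" "Comp K (Comp K g h) k = g"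
      by (rule inverse_arrows_cancel(2)[OF that(1)]; use that(2-4) in \<open>simp add: Hom_def\<close>)+
    then show ?thesis using that(5) by metis
  qed
  show ?thesis
  proof (rule is_pullbackI[OF p' q' r' s'])
    have "Comp K (Comp K p' r') tx = Comp K (Comp K q' s') tx"
      using assoc_Hom[OF x(2) r' p'] assoc_Hom[OF x(2) s' q'] com
        assoc_Hom[OF P(3) c(2) p'] assoc_Hom[OF P(4) e(2) q']
        assoc_Hom[OF P(3) P(1) d(2)] assoc_Hom[OF P(4) P(2) d(2)] P(5) by simp
    then show "Comp K p' r' = Comp K q' s'"
      by (rule cancr[OF x Comp_Hom[OF r' p'] Comp_Hom[OF s' q']])
  next
    fix w k l assume k: "k \<in> Hom K w c'" and l: "l \<in> Hom K w e'" and kl: "Comp K p' k = Comp K q' l"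
    note tk = Comp_Hom[OF k c'] and tl = Comp_Hom[OF l e']
    have "Comp K td (Comp K p (Comp K tc' k)) = Comp K td (Comp K q (Comp K te' l))"
      using assoc_Hom[OF tk P(1) d(2)] assoc_Hom[OF tl P(2) d(2)] assoc_Hom[OF tk c(2) p']
        assoc_Hom[OF tl e(2) q'] com canc'[OF c k] canc'[OF e l] kl by simp
    then have "Comp K p (Comp K tc' k) = Comp K q (Comp K te' l)"
      using canc[OF d Comp_Hom[OF tk P(1)]] canc[OF d Comp_Hom[OF tl P(2)]] by metis
    then obtain h where h: "h \<in> Hom K w (Dom K r)" "Comp K r h = Comp K tc' k" "Comp K s h = Comp K te' l"
      by (rule is_pullback_ex[OF pb tk tl])
    have "Comp K r' (Comp K tx h) = k"
      using assoc_Hom[OF h(1) x(2) r'] assoc_Hom[OF h(1) P(3) c(2)] com h canc'[OF c k] by simp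
    moreover have "Comp K s' (Comp K tx h) = l"
      using assoc_Hom[OF h(1) x(2) s'] assoc_Hom[OF h(1) P(4) e(2)] com h canc'[OF e l] by simp
    ultimately show "\<exists>h\<in>Hom K w x'. Comp K r' h = k \<and> Comp K s' h = l"
      using Comp_Hom[OF h(1) x(2)] by blast
  next
    fix w h h' assume h: "h \<in> Hom K w x'" and h': "h' \<in> Hom K w x'"
      and eq: "Comp K r' h = Comp K r' h'" "Comp K s' h = Comp K s' h'"
    have r_eq: "Comp K r (Comp K tx' k) = Comp K tc' (Comp K r' k)" if k: "k \<in> Hom K w x'" for k
    proof -
      note xk = Comp_Hom[OF k x']
      have "Comp K tc (Comp K r (Comp K tx' k)) = Comp K r' k"
        using assoc_Hom[OF xk P(3) c(2)] assoc_Hom[OF xk x(2) r'] com canc'[OF x k] by simp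
      then show ?thesis using canc[OF c Comp_Hom[OF xk P(3)]] by simp
    qed
    have s_eq: "Comp K s (Comp K tx' k) = Comp K te' (Comp K s' k)" if k: "k \<in> Hom K w x'" for k
    proof -
      note xk = Comp_Hom[OF k x']
      have "Comp K te (Comp K s (Comp K tx' k)) = Comp K s' k"
        using assoc_Hom[OF xk P(4) e(2)] assoc_Hom[OF xk x(2) s'] com canc'[OF x k] by simp
      then show ?thesis using canc[OF e Comp_Hom[OF xk P(4)]] by simp
    qed
    have "Comp K tx' h = Comp K tx' h'"
      by (rule is_pullback_eq[OF pb Comp_Hom[OF h x'] Comp_Hom[OF h' x']])
        (simp_all add: r_eq[OF h] r_eq[OF h'] s_eq[OF h] s_eq[OF h'] eq)
    then show "h = h'" using canc'[OF x h] canc'[OF x h'] by metis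
  qed
qed

end

section \<open>Flatness and cobase change\<close>

text \<open>
  \<open>k\<close> is the image of \<open>g : u \<rightarrow> v\<close>, a map under the domain of \<open>f\<close>, under push-out along \<open>f\<close>, where
  the push-outs \<open>(i, j)\<close> of \<open>u\<close> and \<open>(i', j')\<close> of \<open>v\<close> are arguments.  The functor
  \<open>pushout_functor\<close> uses chosen push-outs instead; but at an object of \<open>C\<close> the chosen push-out of
  diagrams need not restrict to the chosen push-out in \<open>M\<close>.
\<close>

definition cobase_change ::
    "('o, 'm, 'x) cat_scheme \<Rightarrow> 'm \<Rightarrow> 'm \<Rightarrow> 'm \<Rightarrow> 'm \<Rightarrow> 'm \<Rightarrow> 'm \<Rightarrow> 'm \<Rightarrow> 'm \<Rightarrow> 'm \<Rightarrow> bool"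
  where "cobase_change K f u i j v i' j' g k \<longleftrightarrow>
    is_pushout K f u i j \<and> is_pushout K f v i' j' \<and>
    g \<in> Hom K (Cod K u) (Cod K v) \<and> Comp K g u = v \<and>
    k \<in> Hom K (Cod K i) (Cod K i') \<and> Comp K k i = i' \<and> Comp K k j = Comp K j' g"

lemma pushout_is_pushout:
  assumes "has_pushouts K" "f \<in> Ar K" "u \<in> Ar K" "Dom K f = Dom K u"
  shows "is_pushout K f u (fst (pushout K f u)) (snd (pushout K f u))"
proof -
  have "\<exists>x. case x of (i, j) \<Rightarrow> is_pushout K f u i j"
    using assms unfolding has_pushouts_def by force
  then have "case pushout K f u of (i, j) \<Rightarrow> is_pushout K f u i j"
    unfolding pushout_def by (rule someI_ex)
  then show ?thesis by (simp add: case_prod_beta)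
qed

context category
begin

lemma pushout_desc:
  assumes po: "is_pushout K f u (fst (pushout K f u)) (snd (pushout K f u))"
    and "i' \<in> Hom K (Cod K f) d" "j' \<in> Hom K (Cod K u) d" "Comp K i' f = Comp K j' u"
  shows "pushout_desc K f u i' j' \<in> Hom K (Cod K (fst (pushout K f u))) d"
    "Comp K (pushout_desc K f u i' j') (fst (pushout K f u)) = i'"
    "Comp K (pushout_desc K f u i' j') (snd (pushout K f u)) = j'"
proof -
  have d: "d = Cod K i'" using assms(2) by (simp add: Hom_def)
  from theI'[OF is_pushout_universal[OF assms], folded pushout_desc_def[of K f u i' j', folded d]]
  show "pushout_desc K f u i' j' \<in> Hom K (Cod K (fst (pushout K f u))) d"
    "Comp K (pushout_desc K f u i' j') (fst (pushout K f u)) = i'"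
    "Comp K (pushout_desc K f u i' j') (snd (pushout K f u)) = j'"
    by blast+
qed

lemma cobase_change_pushout_functor:
  assumes has: "has_pushouts K" and f: "f \<in> Ar K" and g: "(u, v, g) \<in> Ar (under_cat K (Dom K f))"
  obtains k where "FAr (pushout_functor K f) (u, v, g) = (fst (pushout K f u), fst (pushout K f v), k)"
    "cobase_change K f u (fst (pushout K f u)) (snd (pushout K f u))
      v (fst (pushout K f v)) (snd (pushout K f v)) g k"
proof -
  have pu: "is_pushout K f u (fst (pushout K f u)) (snd (pushout K f u))"
    and pv: "is_pushout K f v (fst (pushout K f v)) (snd (pushout K f v))"
    using g f by (auto intro!: pushout_is_pushout[OF has])
  have u: "u \<in> Hom K (Dom K f) (Cod K u)" and gH: "g \<in> Hom K (Cod K u) (Cod K v)" and gu: "Comp K g u = v"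
    using g by (auto simp: Hom_def)
  note V = is_pushoutD[OF pv]
  have "Comp K (fst (pushout K f v)) f = Comp K (Comp K (snd (pushout K f v)) g) u"
    using assoc_Hom[OF u gH V(4)] V(5) gu by simp
  note desc = pushout_desc[OF pu V(3) Comp_Hom[OF gH V(4)] this]
  show thesis
    by (rule that) (use pu pv gH gu desc in \<open>auto simp: pushout_functor_def cobase_change_def\<close>)
qed

lemma cobase_change_under:
  assumes "cobase_change K f u i j v i' j' g k"
  shows "(u, v, g) \<in> Ar (under_cat K (Dom K f))" "(i, i', k) \<in> Ar (under_cat K (Cod K f))"
  using assms unfolding cobase_change_def is_pushout_def by auto

lemma cobase_change_commutes:
  assumes k: "cobase_change K f u i j v i' j' g k" and l: "cobase_change K f u a b v a' b' g l"
    and t: "t \<in> Hom K (Cod K i) (Cod K a)" "Comp K t i = a" "Comp K t j = b"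
    and t': "t' \<in> Hom K (Cod K i') (Cod K a')" "Comp K t' i' = a'" "Comp K t' j' = b'"
  shows "Comp K l t = Comp K t' k"
proof -
  have po: "is_pushout K f u i j" and po': "is_pushout K f v i' j'"
    and k': "k \<in> Hom K (Cod K i) (Cod K i')" "Comp K k i = i'" "Comp K k j = Comp K j' g"
    and l': "l \<in> Hom K (Cod K a) (Cod K a')" "Comp K l a = a'" "Comp K l b = Comp K b' g"
    and g: "g \<in> Hom K (Cod K u) (Cod K v)"
    using k l by (auto simp: cobase_change_def)
  note I = is_pushoutD[OF po] and I' = is_pushoutD[OF po']
  show ?thesis
  proof (rule is_pushout_eq[OF po Comp_Hom[OF t(1) l'(1)] Comp_Hom[OF k'(1) t'(1)]])
    show "Comp K (Comp K l t) i = Comp K (Comp K t' k) i"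
      using assoc_Hom[OF I(3) t(1) l'(1)] assoc_Hom[OF I(3) k'(1) t'(1)] t t' k' l' by simp
    show "Comp K (Comp K l t) j = Comp K (Comp K t' k) j"
      using assoc_Hom[OF I(4) t(1) l'(1)] assoc_Hom[OF I(4) k'(1) t'(1)]
        assoc_Hom[OF g I'(4) t'(1)] t t' k' l' by simp
  qed
qed

end

lemma is_pullback_under_model: "is_pullback (under_model M A) p q r s \<longleftrightarrow> is_pullback (under_cat M A) p q r s"
  by (simp add: is_pullback_def under_model_def cat.defs model_cat.defs Hom_def)

lemma TFib_under_model: "(u, v, g) \<in> TFib (under_model M A) \<longleftrightarrow> (u, v, g) \<in> Ar (under_cat M A) \<and> g \<in> TFib M"
  by (auto simp: TFib_def under_model_def cat.defs model_cat.defs)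

context model_category
begin

text \<open>
  A map isomorphic to \<open>p\<close> is in particular a retract of \<open>p\<close>.
\<close>

lemma TFib_isomorphic:
  assumes p: "p \<in> TFib M" and q: "q \<in> Ar M"
    and t: "inverse_arrows t s" "t \<in> Hom M (Dom M p) (Dom M q)"
    and t': "inverse_arrows t' s'" "t' \<in> Hom M (Cod M p) (Cod M q)"
    and com: "Comp M q t = Comp M t' p"
  shows "q \<in> TFib M"
proof -
  have pA: "p \<in> Ar M" using p Fib_Ar by (auto simp: TFib_def)
  have s: "s \<in> Hom M (Dom M q) (Dom M p)" "Comp M s t = Id M (Dom M p)" "Comp M t s = Id M (Dom M q)"
    and s': "s' \<in> Hom M (Cod M q) (Cod M p)" "Comp M s' t' = Id M (Cod M p)" "Comp M t' s' = Id M (Cod M q)"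
    using t t' by (auto simp: inverse_arrows_def Hom_def)
  have pH: "p \<in> Hom M (Dom M p) (Cod M p)" and qH: "q \<in> Hom M (Dom M q) (Cod M q)"
    using pA q by (auto simp: Hom_def)
  have "Comp M s' (Comp M (Comp M q t) s) = Comp M s' (Comp M (Comp M t' p) s)"
    using com by simp
  then have "Comp M p s = Comp M s' q"
    using assoc_Hom[OF s(1) t(2) qH] assoc_Hom[OF s(1) pH t'(2)]
      assoc_Hom[OF Comp_Hom[OF s(1) pH] t'(2) s'(1)] s s' Comp_Id_Hom[OF qH] Id_Comp_Hom[OF Comp_Hom[OF s(1) pH]]
    by simp
  then have "retract_of M q p"
    unfolding retract_of_def using pA q s s' t t' com by blast
  then show ?thesis
    using p Fib_retract Weq_retract by (auto simp: TFib_def)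
qed

text \<open>
  Flatness speaks of the chosen push-outs only; this lemma and the next extend it to all of them by
  comparing through the canonical isomorphisms, which are compatible with the induced maps by
  \<open>cobase_change_commutes\<close>.
\<close>

lemma flat_TFib:
  assumes has: "has_pushouts M" and fl: "flat M f" and k: "cobase_change M f u i j v i' j' g k" and g: "g \<in> TFib M"
  shows "k \<in> TFib M"
proof -
  have f: "f \<in> Ar M" using fl by (simp add: flat_def)
  note un = cobase_change_under[OF k]
  obtain l where l: "FAr (pushout_functor M f) (u, v, g) = (fst (pushout M f u), fst (pushout M f v), l)"
    and lc: "cobase_change M f u (fst (pushout M f u)) (snd (pushout M f u))
      v (fst (pushout M f v)) (snd (pushout M f v)) g l"
    by (rule cobase_change_pushout_functor[OF has f un(1)])
  have "(u, v, g) \<in> TFib (under_model M (Dom M f))"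
    using un g by (simp only: TFib_under_model)
  then have "FAr (pushout_functor M f) (u, v, g) \<in> TFib (under_model M (Cod M f))"
    using fl unfolding flat_def preserves_pullbacks_of_TFib_def by blast
  then have lT: "l \<in> TFib M" by (simp add: l TFib_under_model)
  obtain t s where t: "inverse_arrows t s" "t \<in> Hom M (Cod M (fst (pushout M f u))) (Cod M i)"
    "Comp M t (fst (pushout M f u)) = i" "Comp M t (snd (pushout M f u)) = j"
    using pushout_comparison k lc unfolding cobase_change_def by metis
  obtain t' s' where t': "inverse_arrows t' s'" "t' \<in> Hom M (Cod M (fst (pushout M f v))) (Cod M i')"
    "Comp M t' (fst (pushout M f v)) = i'" "Comp M t' (snd (pushout M f v)) = j'"
    using pushout_comparison k lc unfolding cobase_change_def by metis
  show ?thesis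
    by (rule TFib_isomorphic[OF lT _ t(1) _ t'(1) _ cobase_change_commutes[OF lc k t(2-4) t'(2-4)]])
      (use k lc t t' in \<open>auto simp: cobase_change_def Hom_def\<close>)
qed

lemma flat_pullback:
  assumes has: "has_pushouts M" "has_pullbacks M" and fl: "flat M f"
    and pb: "is_pullback M p q r s" and p: "p \<in> TFib M"
    and P: "cobase_change M f c ci cj d di dj p p'" and Q: "cobase_change M f e ei ej d di dj q q'"
    and R: "cobase_change M f x xi xj c ci cj r r'" and S: "cobase_change M f x xi xj e ei ej s s'"
  shows "is_pullback M p' q' r' s'"
proof -
  have f: "f \<in> Ar M" using fl by (simp add: flat_def)
  note un = cobase_change_under(1)[OF P] cobase_change_under(1)[OF Q] cobase_change_under(1)[OF R]
    cobase_change_under(1)[OF S]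
  let ?F = "FAr (pushout_functor M f)" and ?i = "\<lambda>u. fst (pushout M f u)" and ?j = "\<lambda>u. snd (pushout M f u)"
  obtain p0 where p0: "?F (c, d, p) = (?i c, ?i d, p0)" and P0: "cobase_change M f c (?i c) (?j c) d (?i d) (?j d) p p0"
    by (rule cobase_change_pushout_functor[OF has(1) f un(1)])
  obtain q0 where q0: "?F (e, d, q) = (?i e, ?i d, q0)" and Q0: "cobase_change M f e (?i e) (?j e) d (?i d) (?j d) q q0"
    by (rule cobase_change_pushout_functor[OF has(1) f un(2)])
  obtain r0 where r0: "?F (x, c, r) = (?i x, ?i c, r0)" and R0: "cobase_change M f x (?i x) (?j x) c (?i c) (?j c) r r0"
    by (rule cobase_change_pushout_functor[OF has(1) f un(3)])
  obtain s0 where s0: "?F (x, e, s) = (?i x, ?i e, s0)" and S0: "cobase_change M f x (?i x) (?j x) e (?i e) (?j e) s s0"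
    by (rule cobase_change_pushout_functor[OF has(1) f un(4)])
  have "(c, d, p) \<in> TFib (under_model M (Dom M f))"
    using un p by (simp only: TFib_under_model)
  then have "is_pullback (under_model M (Cod M f)) (?F (c, d, p)) (?F (e, d, q)) (?F (x, c, r)) (?F (x, e, s))"
    using fl pullback_in_under_cat[OF pb un]
    unfolding flat_def preserves_pullbacks_of_TFib_def is_pullback_under_model by blast
  then have pb0: "is_pullback M p0 q0 r0 s0"
    unfolding p0 q0 r0 s0 is_pullback_under_model by (rule pullback_if_under_cat[OF has(2)])
  have cmp: "\<exists>t s. inverse_arrows t s \<and> t \<in> Hom M (Cod M (?i u)) (Cod M i) \<and> Comp M t (?i u) = i \<and>
      Comp M t (?j u) = j" if "is_pushout M f u i j" "is_pushout M f u (?i u) (?j u)" for u i j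
    using pushout_comparison[OF that(2,1)] by metis
  obtain tc tc' where tc: "inverse_arrows tc tc'" "tc \<in> Hom M (Cod M (?i c)) (Cod M ci)"
    "Comp M tc (?i c) = ci" "Comp M tc (?j c) = cj"
    using cmp P P0 unfolding cobase_change_def by metis
  obtain td td' where td: "inverse_arrows td td'" "td \<in> Hom M (Cod M (?i d)) (Cod M di)"
    "Comp M td (?i d) = di" "Comp M td (?j d) = dj"
    using cmp P P0 unfolding cobase_change_def by metis
  obtain te te' where te: "inverse_arrows te te'" "te \<in> Hom M (Cod M (?i e)) (Cod M ei)"
    "Comp M te (?i e) = ei" "Comp M te (?j e) = ej"
    using cmp Q Q0 unfolding cobase_change_def by metis
  obtain tx tx' where tx: "inverse_arrows tx tx'" "tx \<in> Hom M (Cod M (?i x)) (Cod M xi)"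
    "Comp M tx (?i x) = xi" "Comp M tx (?j x) = xj"
    using cmp R R0 unfolding cobase_change_def by metis
  have ends: "Dom M p0 = Cod M (?i c)" "Cod M p0 = Cod M (?i d)" "Dom M q0 = Cod M (?i e)" "Dom M r0 = Cod M (?i x)"
    using P0 Q0 R0 by (auto simp: cobase_change_def Hom_def)
  show ?thesis
  proof (rule pullback_square_isomorphic[OF pb0 _ _ _ _ tc(1) _ td(1) _ te(1) _ tx(1)])
    show "p' \<in> Hom M (Cod M ci) (Cod M di)" "q' \<in> Hom M (Cod M ei) (Cod M di)"
      "r' \<in> Hom M (Cod M xi) (Cod M ci)" "s' \<in> Hom M (Cod M xi) (Cod M ei)"
      using P Q R S by (auto simp: cobase_change_def)
    show "Comp M p' tc = Comp M td p0" by (rule cobase_change_commutes[OF P0 P tc(2-) td(2-)])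
    show "Comp M q' te = Comp M td q0" by (rule cobase_change_commutes[OF Q0 Q te(2-) td(2-)])
    show "Comp M r' tx = Comp M tc r0" by (rule cobase_change_commutes[OF R0 R tx(2-) tc(2-)])
    show "Comp M s' tx = Comp M te s0" by (rule cobase_change_commutes[OF S0 S tx(2-) te(2-)])
  qed (use tc td te tx ends in simp_all)
qed

end

section \<open>Objectwise flat maps of diagrams\<close>

lemma reedy_simps:
  "Ob (reedy C M) = fun_objects C M" "Ar (reedy C M) = fun_arrows C M" "Dom (reedy C M) = NDom"
  "Cod (reedy C M) = NCod" "Id (reedy C M) = Id (fun_cat C M)" "Comp (reedy C M) = Comp (fun_cat C M)"
  "Cof (reedy C M) = {t \<in> fun_arrows C M. \<forall>a\<in>Ob C. relative_latching_map C M t a \<in> Cof M}"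
  "Fib (reedy C M) = {t \<in> fun_arrows C M. \<forall>a\<in>Ob C. Cmp t a \<in> Fib M}"
  "Weq (reedy C M) = {t \<in> fun_arrows C M. \<forall>a\<in>Ob C. Cmp t a \<in> Weq M}"
  by (simp_all add: reedy_def fun_cat_def cat.defs model_cat.defs)

lemma under_cat_reedy: "under_cat (reedy C M) X = under_cat (fun_cat C M) X"
  unfolding under_cat_def Hom_def reedy_simps fun_cat_simps(1-4) ..

lemma is_pushout_reedy: "is_pushout (reedy C M) = is_pushout (fun_cat C M)"
  unfolding is_pushout_def[abs_def] Hom_def reedy_simps fun_cat_simps(1-4) ..

lemma pushout_functor_reedy: "pushout_functor (reedy C M) t = pushout_functor (fun_cat C M) t"
  unfolding pushout_functor_def pushout_desc_def pushout_def is_pushout_reedy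
  unfolding Hom_def reedy_simps fun_cat_simps(1-4) ..

lemma TFib_reedy: "t \<in> TFib (reedy C M) \<longleftrightarrow> t \<in> fun_arrows C M \<and> (\<forall>a\<in>Ob C. Cmp t a \<in> TFib M)"
  by (auto simp: TFib_def reedy_simps)

lemma (in functor_category) pointwise_cobase_change:
  assumes has: "has_pushouts D" and k: "cobase_change (fun_cat C D) f u i j v i' j' g k" and a: "a \<in> Ob C"
  shows "cobase_change D (Cmp f a) (Cmp u a) (Cmp i a) (Cmp j a) (Cmp v a) (Cmp i' a) (Cmp j' a)
    (Cmp g a) (Cmp k a)"
proof -
  have g: "g \<in> Hom (fun_cat C D) (NCod u) (NCod v)" "Comp (fun_cat C D) g u = v"
    and kk: "k \<in> Hom (fun_cat C D) (NCod i) (NCod i')" "Comp (fun_cat C D) k i = i'"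
      "Comp (fun_cat C D) k j = Comp (fun_cat C D) j' g"
    and po: "is_pushout (fun_cat C D) f u i j" "is_pushout (fun_cat C D) f v i' j'"
    using k by (auto simp: cobase_change_def)
  have ars: "u \<in> fun_arrows C D" "v \<in> fun_arrows C D" "i \<in> fun_arrows C D" "i' \<in> fun_arrows C D"
    "g \<in> fun_arrows C D" "k \<in> fun_arrows C D"
    using po g kk by (auto simp: is_pushout_def Hom_def)
  show ?thesis
    unfolding cobase_change_def
    using pointwise_if_pushout[OF has po(1) a] pointwise_if_pushout[OF has po(2) a]
      arg_cong[OF g(2), of "\<lambda>t. Cmp t a"] arg_cong[OF kk(2), of "\<lambda>t. Cmp t a"]
      arg_cong[OF kk(3), of "\<lambda>t. Cmp t a"] a g(1) kk(1)
      ars[THEN fun_arrowD(3), OF a]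
    by (simp add: Hom_def)
qed

text \<open>
  In a category of diagrams, push-outs, pull-backs and trivial fibrations, and hence also cobase
  change along \<open>t\<close>, are all computed at the objects, so that the two conditions in the definition of
  flatness may be checked there.
\<close>

lemma (in model_category) flat_if_pointwise:
  assumes C: "category C" and has: "has_pushouts M" "has_pullbacks M"
    and t: "t \<in> fun_arrows C M" and fl: "\<And>a. a \<in> Ob C \<Longrightarrow> flat M (Cmp t a)"
  shows "flat (reedy C M) t"
proof -
  interpret functor_category C M
    by (intro functor_category.intro C) unfold_locales
  note hasf = has_pushouts_fun_cat[OF has(1)] has_pullbacks_fun_cat[OF has(2)]
  let ?F = "pushout_functor (fun_cat C M) t" and ?i = "\<lambda>u. fst (pushout (fun_cat C M) t u)"
    and ?j = "\<lambda>u. snd (pushout (fun_cat C M) t u)"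
  have tA: "t \<in> Ar (fun_cat C M)" using t by simp
  have F: "\<exists>k. FAr ?F (u, v, g) = (?i u, ?i v, k) \<and>
      cobase_change (fun_cat C M) t u (?i u) (?j u) v (?i v) (?j v) g k"
    if "(u, v, g) \<in> Ar (under_cat (fun_cat C M) (NDom t))" for u v g
    using fc.cobase_change_pushout_functor[OF hasf(1) tA, of u v g] that by force
  have tfib: "FAr ?F P \<in> TFib (under_model (reedy C M) (NCod t))"
    if P: "P \<in> TFib (under_model (reedy C M) (NDom t))" for P
  proof -
    obtain u v g where uvg: "P = (u, v, g)" by (cases P)
    with P have g: "(u, v, g) \<in> Ar (under_cat (fun_cat C M) (NDom t))" "g \<in> TFib (reedy C M)"
      unfolding uvg TFib_under_model under_cat_reedy by blast+
    obtain k where Fk: "FAr ?F P = (?i u, ?i v, k)"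
      and k: "cobase_change (fun_cat C M) t u (?i u) (?j u) v (?i v) (?j v) g k"
      using F[OF g(1)] uvg by blast
    have "Cmp k a \<in> TFib M" if a: "a \<in> Ob C" for a
      using flat_TFib[OF has(1) fl[OF a] pointwise_cobase_change[OF has(1) k a]] g(2) a by (simp add: TFib_reedy)
    moreover have "k \<in> fun_arrows C M" using k by (simp add: cobase_change_def Hom_def)
    ultimately have "k \<in> TFib (reedy C M)" by (simp add: TFib_reedy)
    moreover have "(?i u, ?i v, k) \<in> Ar (under_cat (fun_cat C M) (NCod t))"
      using fc.cobase_change_under(2)[OF k] by simp
    ultimately show ?thesis
      unfolding Fk TFib_under_model under_cat_reedy by blast
  qed
  have pull: "is_pullback (under_model (reedy C M) (NCod t)) (FAr ?F P) (FAr ?F Q) (FAr ?F R) (FAr ?F S)"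
    if P: "P \<in> TFib (under_model (reedy C M) (NDom t))"
      and pb: "is_pullback (under_model (reedy C M) (NDom t)) P Q R S" for P Q R S
  proof -
    have pb': "is_pullback (under_cat (fun_cat C M) (NDom t)) P Q R S"
      using pb unfolding is_pullback_under_model under_cat_reedy .
    obtain c d e x p q r s where PQRS: "P = (c, d, p)" "Q = (e, d, q)" "R = (x, c, r)" "S = (x, e, s)"
      and ar: "(c, d, p) \<in> Ar (under_cat (fun_cat C M) (NDom t))" "(e, d, q) \<in> Ar (under_cat (fun_cat C M) (NDom t))"
        "(x, c, r) \<in> Ar (under_cat (fun_cat C M) (NDom t))" "(x, e, s) \<in> Ar (under_cat (fun_cat C M) (NDom t))"
      by (rule fc.under_pullbackE[OF pb'])
    have pbf: "is_pullback (fun_cat C M) p q r s"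
      by (rule fc.pullback_if_under_cat[OF hasf(2)]) (use pb' PQRS in simp)
    have p: "p \<in> TFib (reedy C M)"
      using P unfolding PQRS TFib_under_model by blast
    obtain p' where p': "FAr ?F P = (?i c, ?i d, p')"
      "cobase_change (fun_cat C M) t c (?i c) (?j c) d (?i d) (?j d) p p'"
      using F[OF ar(1)] PQRS by blast
    obtain q' where q': "FAr ?F Q = (?i e, ?i d, q')"
      "cobase_change (fun_cat C M) t e (?i e) (?j e) d (?i d) (?j d) q q'"
      using F[OF ar(2)] PQRS by blast
    obtain r' where r': "FAr ?F R = (?i x, ?i c, r')"
      "cobase_change (fun_cat C M) t x (?i x) (?j x) c (?i c) (?j c) r r'"
      using F[OF ar(3)] PQRS by blast
    obtain s' where s': "FAr ?F S = (?i x, ?i e, s')"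
      "cobase_change (fun_cat C M) t x (?i x) (?j x) e (?i e) (?j e) s s'"
      using F[OF ar(4)] PQRS by blast
    have "is_pullback (fun_cat C M) p' q' r' s'"
    proof (rule pullback_if_pointwise)
      show "is_pullback M (Cmp p' a) (Cmp q' a) (Cmp r' a) (Cmp s' a)" if a: "a \<in> Ob C" for a
      proof (rule flat_pullback[OF has fl[OF a] pointwise_if_pullback[OF has(2) pbf a]])
        show "Cmp p a \<in> TFib M" using p a by (simp add: TFib_reedy)
      qed (rule pointwise_cobase_change[OF has(1) _ a], fact p' q' r' s')+
    qed (use p'(2) q'(2) r'(2) s'(2) in \<open>auto simp: cobase_change_def Hom_def\<close>)
    then have "is_pullback (under_cat (fun_cat C M) (NCod t)) (?i c, ?i d, p') (?i e, ?i d, q') (?i x, ?i c, r') (?i x, ?i e, s')"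
      using fc.cobase_change_under(2)[OF p'(2)] fc.cobase_change_under(2)[OF q'(2)]
        fc.cobase_change_under(2)[OF r'(2)] fc.cobase_change_under(2)[OF s'(2)]
      by (intro fc.pullback_in_under_cat) (simp_all only: fun_cat_simps)
    then show ?thesis
      unfolding is_pullback_under_model under_cat_reedy p'(1) q'(1) r'(1) s'(1) .
  qed
  show ?thesis
    unfolding flat_def preserves_pullbacks_of_TFib_def pushout_functor_reedy
    using t tfib pull by (simp add: reedy_simps)
qed

section \<open>Reedy cofibrations are objectwise cofibrations\<close>

lemma latching_cat_simps:
  "Ob (latching_cat C a) = {f \<in> Ar C. Cod C f = a \<and> f \<noteq> Id C a}"
  "Ar (latching_cat C a) = {(f, g, h). f \<in> Ob (latching_cat C a) \<and> g \<in> Ob (latching_cat C a) \<and>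
    h \<in> Hom C (Dom C f) (Dom C g) \<and> Comp C g h = f}"
  "Dom (latching_cat C a) (f, g, h) = f"
  "Cod (latching_cat C a) (f, g, h) = g"
  "Id (latching_cat C a) f = (f, f, Id C (Dom C f))"
  "Comp (latching_cat C a) (g', k, h') (f, g, h) = (f, k, Comp C h' h)"
  by (simp_all add: latching_cat_def)

lemma (in category) category_latching_cat: "category (latching_cat K a)"
proof
  fix f g h assume "f \<in> Ar (latching_cat K a)" "g \<in> Ar (latching_cat K a)" "h \<in> Ar (latching_cat K a)"
    "Cod (latching_cat K a) f = Dom (latching_cat K a) g" "Cod (latching_cat K a) g = Dom (latching_cat K a) h"
  then show "Comp (latching_cat K a) (Comp (latching_cat K a) h g) f =
      Comp (latching_cat K a) h (Comp (latching_cat K a) g f)"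
    by (cases f; cases g; cases h) (auto simp: latching_cat_simps assoc_Hom)
next
  fix f g assume *: "f \<in> Ar (latching_cat K a)" "g \<in> Ar (latching_cat K a)"
    "Cod (latching_cat K a) f = Dom (latching_cat K a) g"
  obtain u v w k l where fg: "f = (u, v, k)" "g = (v, w, l)"
    using * by (cases f; cases g) (auto simp: latching_cat_simps)
  have "k \<in> Hom K (Dom K u) (Dom K v)" "l \<in> Hom K (Dom K v) (Dom K w)" "w \<in> Hom K (Dom K w) a"
    using * fg by (auto simp: Hom_def latching_cat_simps)
  from assoc_Hom[OF this] Comp_Hom[OF this(1,2)] * fg
  show "Comp (latching_cat K a) g f \<in> Ar (latching_cat K a)"
    "Dom (latching_cat K a) (Comp (latching_cat K a) g f) = Dom (latching_cat K a) f"
    "Cod (latching_cat K a) (Comp (latching_cat K a) g f) = Cod (latching_cat K a) g"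
    by (auto simp: latching_cat_simps)
next
  fix f assume "f \<in> Ar (latching_cat K a)"
  then show "Dom (latching_cat K a) f \<in> Ob (latching_cat K a)" "Cod (latching_cat K a) f \<in> Ob (latching_cat K a)"
    "Comp (latching_cat K a) f (Id (latching_cat K a) (Dom (latching_cat K a) f)) = f"
    "Comp (latching_cat K a) (Id (latching_cat K a) (Cod (latching_cat K a) f)) f = f"
    by (cases f; auto simp: latching_cat_simps Comp_Id_Hom Id_Comp_Hom)+
qed (auto simp: latching_cat_simps Id_Hom Dom_Ob Comp_Id)

lemma (in functor_category) is_functor_latching_diagram:
  assumes X: "X \<in> fun_objects C D"
  shows "is_functor (latching_cat C a) D (latching_diagram C X)"
  unfolding is_functor_def
proof (intro conjI ballI impI)
  fix f assume "f \<in> Ob (latching_cat C a)"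
  then show "FOb (latching_diagram C X) f \<in> Ob D"
    "FAr (latching_diagram C X) (Id (latching_cat C a) f) = Id D (FOb (latching_diagram C X) f)"
    using fun_objectD(1,3)[OF X] by (auto simp: latching_diagram_def latching_cat_simps dom.Dom_Ob)
next
  fix f assume "f \<in> Ar (latching_cat C a)"
  then show "FAr (latching_diagram C X) f \<in> Hom D (FOb (latching_diagram C X) (Dom (latching_cat C a) f))
      (FOb (latching_diagram C X) (Cod (latching_cat C a) f))"
    using fun_objectD(2)[OF X] by (cases f) (auto simp: latching_diagram_def latching_cat_simps Hom_def)
next
  fix f g assume "f \<in> Ar (latching_cat C a)" "g \<in> Ar (latching_cat C a)"
    "Cod (latching_cat C a) f = Dom (latching_cat C a) g"
  then show "FAr (latching_diagram C X) (Comp (latching_cat C a) g f) =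
      Comp D (FAr (latching_diagram C X) g) (FAr (latching_diagram C X) f)"
    using fun_objectD(4)[OF X]
    by (cases f; cases g) (auto simp: latching_diagram_def latching_cat_simps Hom_def)
qed

locale diagrams = functor_category C M
  for C :: "('u::infinite, 'u) cat" and M :: "('o, 'm, 'x) model_cat_scheme" +
  assumes cocomplete: "has_small_colimits TYPE('u) M"
begin

lemma latching_colimit:
  assumes "X \<in> fun_objects C M"
  shows "is_colimit (latching_cat C a) M (latching_diagram C X) (latching_obj C M X a) (latching_inj C M X a)"
proof -
  obtain e :: "'u \<times> 'u \<times> 'u \<Rightarrow> 'u" where "inj e" using ex_inj_triple by blast
  then have "\<exists>L i. is_colimit (latching_cat C a) M (latching_diagram C X) L i"
    using inj_on_subset[OF _ subset_UNIV]
    by (intro has_small_colimits_shape[OF cocomplete dom.category_latching_cat inj_on_id2 _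
        is_functor_latching_diagram[OF assms], of e]) blast
  then have "\<exists>x. case x of (L, i) \<Rightarrow> is_colimit (latching_cat C a) M (latching_diagram C X) L i" by simp
  then have "case colim (latching_cat C a) M (latching_diagram C X) of (L, i) \<Rightarrow>
      is_colimit (latching_cat C a) M (latching_diagram C X) L i"
    unfolding colim_def by (rule someI_ex)
  then show ?thesis by (simp add: case_prod_beta latching_obj_def latching_inj_def)
qed

text \<open>
  An arrow of the latching category with target
  \<open>f\<close> is given by \<open>h\<close> alone, its source being the composite \<open>f h\<close>, which only has to differ from the
  identity.
\<close>

definition latching_cocone :: "('u, 'u, 'o, 'm) fnctr \<Rightarrow> 'u \<Rightarrow> 'o \<Rightarrow> ('u \<Rightarrow> 'm) \<Rightarrow> bool"
  where "latching_cocone X a E c \<longleftrightarrow> E \<in> Ob M \<and>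
    (\<forall>f\<in>Ob (latching_cat C a). c f \<in> Hom M (FOb X (Dom C f)) E) \<and>
    (\<forall>f\<in>Ob (latching_cat C a). \<forall>h\<in>Ar C. Cod C h = Dom C f \<longrightarrow> Comp C f h \<noteq> Id C a \<longrightarrow>
      Comp M (c f) (FAr X h) = c (Comp C f h))"

lemma is_cocone_latching:
  "is_cocone (latching_cat C a) M (latching_diagram C X) E c \<longleftrightarrow> latching_cocone X a E c"
  unfolding is_cocone_def latching_cocone_def
  by (fastforce simp: latching_cat_simps latching_diagram_def Hom_def dom.Comp_Ar dom.Cod_Comp dom.Dom_Comp)

lemma latching_universal:
  assumes X: "X \<in> fun_objects C M" and c: "latching_cocone X a E c"
  shows "\<exists>!l. l \<in> Hom M (latching_obj C M X a) E \<and>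
    (\<forall>f\<in>Ob (latching_cat C a). Comp M l (latching_inj C M X a f) = c f)"
  using latching_colimit[OF X, of a] c unfolding is_colimit_def is_cocone_latching by blast

lemma latching_inj_cocone:
  assumes X: "X \<in> fun_objects C M"
  shows "latching_cocone X a (latching_obj C M X a) (latching_inj C M X a)"
  using latching_colimit[OF X, of a] unfolding is_colimit_def is_cocone_latching by blast

lemma latching_ext:
  assumes X: "X \<in> fun_objects C M" and l: "l \<in> Hom M (latching_obj C M X a) E" and k: "k \<in> Hom M (latching_obj C M X a) E"
    and eq: "\<And>f. f \<in> Ob (latching_cat C a) \<Longrightarrow>
      Comp M l (latching_inj C M X a f) = Comp M k (latching_inj C M X a f)"
  shows "l = k"
proof -
  note I = latching_inj_cocone[OF X, of a, unfolded latching_cocone_def]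
  have "latching_cocone X a E (\<lambda>f. Comp M l (latching_inj C M X a f))"
    unfolding latching_cocone_def
  proof (intro conjI ballI impI)
    show "E \<in> Ob M" using cod.Hom_Ob[OF l] by simp
    fix f assume f: "f \<in> Ob (latching_cat C a)"
    then have If: "latching_inj C M X a f \<in> Hom M (FOb X (Dom C f)) (latching_obj C M X a)" using I by blast
    show "Comp M l (latching_inj C M X a f) \<in> Hom M (FOb X (Dom C f)) E" by (rule cod.Comp_Hom[OF If l])
    fix h assume h: "h \<in> Ar C" "Cod C h = Dom C f" "Comp C f h \<noteq> Id C a"
    then have "FAr X h \<in> Hom M (FOb X (Dom C h)) (FOb X (Dom C f))" using fun_objectD(2)[OF X h(1)] by simp
    from cod.assoc_Hom[OF this If l] I f h
    show "Comp M (Comp M l (latching_inj C M X a f)) (FAr X h) = Comp M l (latching_inj C M X a (Comp C f h))"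
      by auto
  qed
  note ex = latching_universal[OF X this]
  show ?thesis
    using the1_equality[OF ex, of l] the1_equality[OF ex, of k] l k eq by auto
qed

lemma latching_map:
  assumes X: "X \<in> fun_objects C M" and a: "a \<in> Ob C"
  shows "latching_map C M X a \<in> Hom M (latching_obj C M X a) (FOb X a)"
    and "f \<in> Ob (latching_cat C a) \<Longrightarrow> Comp M (latching_map C M X a) (latching_inj C M X a f) = FAr X f"
proof -
  have "latching_cocone X a (FOb X a) (FAr X)"
    using fun_objectD[OF X] a by (auto simp: latching_cocone_def latching_cat_simps)
  from theI'[OF latching_universal[OF X this], folded latching_map_def[of C M X a]]
  show "latching_map C M X a \<in> Hom M (latching_obj C M X a) (FOb X a)"
    and "f \<in> Ob (latching_cat C a) \<Longrightarrow> Comp M (latching_map C M X a) (latching_inj C M X a f) = FAr X f"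
    by blast+
qed

lemma latching_nat:
  assumes t: "t \<in> fun_arrows C M"
  shows "latching_nat C M t a \<in> Hom M (latching_obj C M (NDom t) a) (latching_obj C M (NCod t) a)"
    and "f \<in> Ob (latching_cat C a) \<Longrightarrow> Comp M (latching_nat C M t a) (latching_inj C M (NDom t) a f) =
      Comp M (latching_inj C M (NCod t) a f) (Cmp t (Dom C f))"
proof -
  note X = fun_arrowD(1)[OF t] and Y = fun_arrowD(2)[OF t]
  note I = latching_inj_cocone[OF Y, of a, unfolded latching_cocone_def]
  have "latching_cocone (NDom t) a (latching_obj C M (NCod t) a)
      (\<lambda>f. Comp M (latching_inj C M (NCod t) a f) (Cmp t (Dom C f)))"
    unfolding latching_cocone_def
  proof (intro conjI ballI impI)
    show "latching_obj C M (NCod t) a \<in> Ob M" using I by blast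
    fix f assume f: "f \<in> Ob (latching_cat C a)"
    then have If: "latching_inj C M (NCod t) a f \<in> Hom M (FOb (NCod t) (Dom C f)) (latching_obj C M (NCod t) a)"
      using I by blast
    have ob: "Dom C f \<in> Ob C" using f dom.Dom_Ob by (simp add: latching_cat_simps)
    note tf = fun_arrowD(3)[OF t ob]
    show "Comp M (latching_inj C M (NCod t) a f) (Cmp t (Dom C f)) \<in> Hom M (FOb (NDom t) (Dom C f)) (latching_obj C M (NCod t) a)"
      by (rule cod.Comp_Hom[OF tf If])
    fix h assume h: "h \<in> Ar C" "Cod C h = Dom C f" "Comp C f h \<noteq> Id C a"
    have fA: "f \<in> Ar C" using f by (simp add: latching_cat_simps)
    note Xh = fun_objectD(2)[OF X h(1), unfolded h(2)] and Yh = fun_objectD(2)[OF Y h(1), unfolded h(2)]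
    note th = fun_arrowD(3)[OF t dom.Dom_Ob[OF h(1)]]
    have "Comp M (latching_inj C M (NCod t) a f) (FAr (NCod t) h) = latching_inj C M (NCod t) a (Comp C f h)"
      using I f h by blast
    then show "Comp M (Comp M (latching_inj C M (NCod t) a f) (Cmp t (Dom C f))) (FAr (NDom t) h) =
        Comp M (latching_inj C M (NCod t) a (Comp C f h)) (Cmp t (Dom C (Comp C f h)))"
      using cod.assoc_Hom[OF Xh tf If] cod.assoc_Hom[OF th Yh If] fun_arrowD(4)[OF t h(1)] h
        dom.Dom_Comp[OF h(1) fA h(2)] by simp
  qed
  from theI'[OF latching_universal[OF X this], folded latching_nat_def[of C M t a]]
  show "latching_nat C M t a \<in> Hom M (latching_obj C M (NDom t) a) (latching_obj C M (NCod t) a)"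
    and "f \<in> Ob (latching_cat C a) \<Longrightarrow> Comp M (latching_nat C M t a) (latching_inj C M (NDom t) a f) =
      Comp M (latching_inj C M (NCod t) a f) (Cmp t (Dom C f))"
    by blast+
qed

text \<open>
  The cocone \<open>c\<close> is a map from the latching object of the target, and with \<open>u\<close> it gives a map from the
  push-out that is the domain of the relative latching map.  A lift against the latter is a lift
  against \<open>t\<close> at \<open>b\<close> which restricts to \<open>c\<close>.
\<close>

lemma lift_extending_latching_cocone:
  assumes has: "has_pushouts M" and t: "t \<in> fun_arrows C M" and b: "b \<in> Ob C"
    and lift: "has_lifting M (relative_latching_map C M t b) p"
    and u: "u \<in> Hom M (FOb (NDom t) b) (Dom M p)" and v: "v \<in> Hom M (FOb (NCod t) b) (Cod M p)"
    and p: "p \<in> Ar M" and sq: "Comp M p u = Comp M v (Cmp t b)"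
    and c: "latching_cocone (NCod t) b (Dom M p) c"
    and cu: "\<And>f. f \<in> Ob (latching_cat C b) \<Longrightarrow> Comp M (c f) (Cmp t (Dom C f)) = Comp M u (FAr (NDom t) f)"
    and cv: "\<And>f. f \<in> Ob (latching_cat C b) \<Longrightarrow> Comp M p (c f) = Comp M v (FAr (NCod t) f)"
  obtains h where "h \<in> Hom M (FOb (NCod t) b) (Dom M p)" "Comp M h (Cmp t b) = u" "Comp M p h = v"
    "\<And>f. f \<in> Ob (latching_cat C b) \<Longrightarrow> Comp M h (FAr (NCod t) f) = c f"
proof -
  define X Y where "X = NDom t" and "Y = NCod t"
  note X = fun_arrowD(1)[OF t, folded X_def] and Y = fun_arrowD(2)[OF t, folded Y_def]
  note tb = fun_arrowD(3)[OF t b, folded X_def Y_def]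
  note u = u[folded X_def] and v = v[folded Y_def] and c = c[folded Y_def]
  note cu = cu[folded X_def] and cv = cv[folded Y_def]
  note lX = latching_map[OF X b] and lY = latching_map[OF Y b]
  note lt = latching_nat[OF t, where a = b, folded X_def Y_def]
  have IX: "latching_inj C M X b f \<in> Hom M (FOb X (Dom C f)) (latching_obj C M X b)"
    and IY: "latching_inj C M Y b f \<in> Hom M (FOb Y (Dom C f)) (latching_obj C M Y b)"
    and tf: "Cmp t (Dom C f) \<in> Hom M (FOb X (Dom C f)) (FOb Y (Dom C f))"
    and nat: "Comp M (Cmp t b) (FAr X f) = Comp M (FAr Y f) (Cmp t (Dom C f))"
    if f: "f \<in> Ob (latching_cat C b)" for f
    using latching_inj_cocone[OF X, of b] latching_inj_cocone[OF Y, of b] f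
      fun_arrowD(3)[OF t dom.Dom_Ob, of f] fun_arrowD(4)[OF t, of f]
    by (auto simp: latching_cocone_def latching_cat_simps X_def Y_def)
  have pH: "p \<in> Hom M (Dom M p) (Cod M p)" using p by (simp add: Hom_def)
  let ?l = "latching_map C M X b" and ?L = "latching_nat C M t b"
  let ?i = "fst (pushout M ?l ?L)" and ?j = "snd (pushout M ?l ?L)"
  have ends: "Cod M ?l = FOb X b" "Cod M ?L = latching_obj C M Y b"
    using lX(1) lt(1) by (auto simp: Hom_def)
  have po: "is_pushout M ?l ?L ?i ?j"
    by (rule pushout_is_pushout[OF has]) (use lX(1) lt(1) in \<open>auto simp: Hom_def\<close>)
  note IJ = cod.is_pushoutD[OF po, unfolded ends]
  have com: "Comp M (Cmp t b) ?l = Comp M (latching_map C M Y b) ?L"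
  proof (rule latching_ext[OF X cod.Comp_Hom[OF lX(1) tb] cod.Comp_Hom[OF lt(1) lY(1)]])
    fix f assume f: "f \<in> Ob (latching_cat C b)"
    show "Comp M (Comp M (Cmp t b) ?l) (latching_inj C M X b f) =
        Comp M (Comp M (latching_map C M Y b) ?L) (latching_inj C M X b f)"
      using cod.assoc_Hom[OF IX[OF f] lX(1) tb] cod.assoc_Hom[OF IX[OF f] lt(1) lY(1)]
        cod.assoc_Hom[OF tf[OF f] IY[OF f] lY(1)] lX(2)[OF f] lY(2)[OF f] lt(2)[OF f] nat[OF f] by simp
  qed
  note rlm = cod.pushout_desc[OF po, unfolded ends, OF tb lY(1) com,
      folded relative_latching_map_def[of C M t b, folded X_def Y_def]]
  let ?r = "relative_latching_map C M t b"
  from theI'[OF latching_universal[OF Y c]]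
  obtain k where k: "k \<in> Hom M (latching_obj C M Y b) (Dom M p)"
    and kc: "\<And>f. f \<in> Ob (latching_cat C b) \<Longrightarrow> Comp M k (latching_inj C M Y b f) = c f" by blast
  have "Comp M u ?l = Comp M k ?L"
  proof (rule latching_ext[OF X cod.Comp_Hom[OF lX(1) u] cod.Comp_Hom[OF lt(1) k]])
    fix f assume f: "f \<in> Ob (latching_cat C b)"
    show "Comp M (Comp M u ?l) (latching_inj C M X b f) = Comp M (Comp M k ?L) (latching_inj C M X b f)"
      using cod.assoc_Hom[OF IX[OF f] lX(1) u] cod.assoc_Hom[OF IX[OF f] lt(1) k]
        cod.assoc_Hom[OF tf[OF f] IY[OF f] k] lX(2)[OF f] lt(2)[OF f] kc[OF f] cu[OF f] by simp
  qed
  then obtain w where w: "w \<in> Hom M (Cod M ?i) (Dom M p)" "Comp M w ?i = u" "Comp M w ?j = k"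
    using cod.is_pushout_ex[OF po, unfolded ends, OF u k] by metis
  have pk: "Comp M p k = Comp M v (latching_map C M Y b)"
  proof (rule latching_ext[OF Y cod.Comp_Hom[OF k pH] cod.Comp_Hom[OF lY(1) v]])
    fix f assume f: "f \<in> Ob (latching_cat C b)"
    show "Comp M (Comp M p k) (latching_inj C M Y b f) = Comp M (Comp M v (latching_map C M Y b)) (latching_inj C M Y b f)"
      using cod.assoc_Hom[OF IY[OF f] k pH] cod.assoc_Hom[OF IY[OF f] lY(1) v] lY(2)[OF f] kc[OF f] cv[OF f] by simp
  qed
  have "Comp M p w = Comp M v ?r"
  proof (rule cod.is_pushout_eq[OF po cod.Comp_Hom[OF w(1) pH] cod.Comp_Hom[OF rlm(1) v]])
    show "Comp M (Comp M p w) ?i = Comp M (Comp M v ?r) ?i"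
      using cod.assoc_Hom[OF IJ(3) w(1) pH] cod.assoc_Hom[OF IJ(3) rlm(1) v] w rlm sq by simp
    show "Comp M (Comp M p w) ?j = Comp M (Comp M v ?r) ?j"
      using cod.assoc_Hom[OF IJ(4) w(1) pH] cod.assoc_Hom[OF IJ(4) rlm(1) v] w rlm pk by simp
  qed
  moreover have "Dom M ?r = Cod M ?i" "Cod M ?r = FOb Y b"
    using rlm(1) by (auto simp: Hom_def)
  ultimately obtain h where h: "h \<in> Hom M (FOb Y b) (Dom M p)" "Comp M h ?r = w" "Comp M p h = v"
    using lift w(1) v unfolding has_lifting_def by metis
  have ht: "Comp M h (Cmp t b) = u"
    using cod.assoc_Hom[OF IJ(3) rlm(1) h(1)] h w rlm by simp
  have hl: "Comp M h (latching_map C M Y b) = k"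
    using cod.assoc_Hom[OF IJ(4) rlm(1) h(1)] h w rlm by simp
  have "Comp M h (FAr Y f) = c f" if f: "f \<in> Ob (latching_cat C b)" for f
    using cod.assoc_Hom[OF IY[OF f] lY(1) h(1)] hl lY(2)[OF f] kc[OF f] by simp
  then show thesis
    using that h(1,3) ht by (simp add: Y_def)
qed

end

text \<open>
  For a lifting problem \<open>(u, v)\<close> at \<open>a\<close>, lifts \<open>H f : Y b \<rightarrow> E\<close> are constructed for all arrows
  \<open>f : b \<rightarrow> a\<close>, compatibly with composition, by induction on the degree of \<open>b\<close>: the lifts at the
  composites \<open>f g\<close> with non-identities \<open>g\<close> into \<open>b\<close> have been found already and form a cocone on the
  latching diagram at \<open>b\<close>, which extends to a lift at \<open>f\<close> by the previous lemma.  The lift at the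
  identity of \<open>a\<close> solves the problem.  This avoids showing that the maps of latching objects are
  cofibrations.
\<close>

lemma (in diagrams) pointwise_lifting:
  assumes direct: "direct_reedy C deg" and has: "has_pushouts M" and t: "t \<in> fun_arrows C M" and p: "p \<in> Ar M"
    and lift: "\<And>b. b \<in> Ob C \<Longrightarrow> has_lifting M (relative_latching_map C M t b) p"
    and a: "a \<in> Ob C"
  shows "has_lifting M (Cmp t a) p"
  unfolding has_lifting_def
proof (intro ballI impI)
  interpret direct_reedy C deg by fact
  define X Y where "X = NDom t" and "Y = NCod t"
  note X = fun_arrowD(1)[OF t, folded X_def] and Y = fun_arrowD(2)[OF t, folded Y_def]
  note t3 = fun_arrowD(3)[OF t, folded X_def Y_def] and t4 = fun_arrowD(4)[OF t, folded X_def Y_def]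
  have ends: "Dom M (Cmp t a) = FOb X a" "Cod M (Cmp t a) = FOb Y a"
    using t3[OF a] by (auto simp: Hom_def)
  have pH: "p \<in> Hom M (Dom M p) (Cod M p)" using p by (simp add: Hom_def)
  fix u v assume "u \<in> Hom M (Dom M (Cmp t a)) (Dom M p)" "v \<in> Hom M (Cod M (Cmp t a)) (Cod M p)"
    and sq: "Comp M p u = Comp M v (Cmp t a)"
  then have u: "u \<in> Hom M (FOb X a) (Dom M p)" and v: "v \<in> Hom M (FOb Y a) (Cod M p)"
    by (simp_all add: ends)
  define S where "S = {f \<in> Ar C. Cod C f = a}"
  \<comment> \<open>The square that \<open>h\<close> has to solve is the given one restricted along \<open>f\<close>.\<close>
  define good where "good f h \<longleftrightarrow> h \<in> Hom M (FOb Y (Dom C f)) (Dom M p) \<and>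
    Comp M h (Cmp t (Dom C f)) = Comp M u (FAr X f) \<and> Comp M p h = Comp M v (FAr Y f)" for f h
  have "\<exists>H. \<forall>f\<in>S. deg (Dom C f) < n \<longrightarrow> good f (H f) \<and>
      (\<forall>g\<in>Ob (latching_cat C (Dom C f)). H (Comp C f g) = Comp M (H f) (FAr Y g))" for n
  proof (induction n)
    case 0
    show ?case by simp
  next
    case (Suc n)
    then obtain H where Hgood: "\<And>f. \<lbrakk>f \<in> S; deg (Dom C f) < n\<rbrakk> \<Longrightarrow> good f (H f)"
      and Hnat: "\<And>f g. \<lbrakk>f \<in> S; deg (Dom C f) < n; g \<in> Ob (latching_cat C (Dom C f))\<rbrakk>
        \<Longrightarrow> H (Comp C f g) = Comp M (H f) (FAr Y g)" by blast
    have step: "\<exists>h. good f h \<and> (\<forall>g\<in>Ob (latching_cat C (Dom C f)). H (Comp C f g) = Comp M h (FAr Y g))"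
      if f: "f \<in> S" and deg: "deg (Dom C f) = n" for f
    proof -
      have fA: "f \<in> Ar C" and fa: "Cod C f = a" using f by (auto simp: S_def)
      define b where "b = Dom C f"
      have b: "b \<in> Ob C" unfolding b_def by (rule dom.Dom_Ob[OF fA])
      note Xf = fun_objectD(2)[OF X fA, folded b_def, unfolded fa] and Yf = fun_objectD(2)[OF Y fA, folded b_def, unfolded fa]
      have fg: "Comp C f g \<in> S" "deg (Dom C (Comp C f g)) < n" "Dom C (Comp C f g) = Dom C g"
        "g \<in> Ar C" "Cod C g = b" if "g \<in> Ob (latching_cat C b)" for g
      proof -
        show g: "g \<in> Ar C" "Cod C g = b" using that by (auto simp: latching_cat_simps)
        then show "Comp C f g \<in> S" "Dom C (Comp C f g) = Dom C g"
          using fA fa dom.Comp_Ar dom.Cod_Comp dom.Dom_Comp by (auto simp: S_def b_def)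
        have "g \<noteq> Id C (Dom C g)"
          using that dom.Cod_Id[OF dom.Dom_Ob[OF g(1)]] by (auto simp: latching_cat_simps)
        then show "deg (Dom C (Comp C f g)) < n"
          using raises_degree[OF g(1)] deg g(2) \<open>Dom C (Comp C f g) = Dom C g\<close> by (simp add: b_def)
      qed
      have gH: "good (Comp C f g) (H (Comp C f g))" if "g \<in> Ob (latching_cat C b)" for g
        using Hgood fg that by blast
      have coc: "latching_cocone Y b (Dom M p) (\<lambda>g. H (Comp C f g))"
        unfolding latching_cocone_def
      proof (intro conjI ballI impI)
        show "Dom M p \<in> Ob M" using cod.Hom_Ob[OF pH] by simp
        fix g assume g: "g \<in> Ob (latching_cat C b)"
        note gg = gH[OF g, unfolded good_def fg(3)[OF g]]
        show "H (Comp C f g) \<in> Hom M (FOb Y (Dom C g)) (Dom M p)" using gg by blast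
        fix h assume h: "h \<in> Ar C" "Cod C h = Dom C g" "Comp C g h \<noteq> Id C b"
        have assoc: "Comp C f (Comp C g h) = Comp C (Comp C f g) h"
          using dom.Comp_assoc[OF h(1) fg(4)[OF g] fA h(2)] fg(5)[OF g] by (simp add: b_def)
        show "Comp M (H (Comp C f g)) (FAr Y h) = H (Comp C f (Comp C g h))"
        \<comment> \<open>For an identity \<open>h\<close> there is nothing to do, and compatibility is assumed for
          non-identities only.\<close>
        proof (cases "h = Id C (Dom C g)")
          case True
          have "Dom C g \<in> Ob C" using dom.Dom_Ob[OF fg(4)[OF g]] .
          then show ?thesis
            using True fun_objectD(3)[OF Y] cod.Comp_Id_Hom[of "H (Comp C f g)"] gg dom.Comp_Id[OF fg(4)[OF g]]
            by auto
        next
          case False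
          then have "h \<in> Ob (latching_cat C (Dom C (Comp C f g)))"
            using h fg(3)[OF g] by (simp add: latching_cat_simps)
          then show ?thesis
            using Hnat[OF fg(1,2)[OF g]] assoc by simp
        qed
      qed
      have sq': "Comp M p (Comp M u (FAr X f)) = Comp M (Comp M v (FAr Y f)) (Cmp t b)"
        using cod.assoc_Hom[OF Xf u pH] cod.assoc_Hom[OF Xf t3[OF a] v] cod.assoc_Hom[OF t3[OF b] Yf v]
          sq t4[OF fA] fa by (simp add: b_def)
      obtain h where h: "h \<in> Hom M (FOb Y b) (Dom M p)" "Comp M h (Cmp t b) = Comp M u (FAr X f)"
        "Comp M p h = Comp M v (FAr Y f)"
        "\<And>g. g \<in> Ob (latching_cat C b) \<Longrightarrow> Comp M h (FAr Y g) = H (Comp C f g)"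
      proof (rule lift_extending_latching_cocone[OF has t b lift[OF b], folded X_def Y_def,
            OF cod.Comp_Hom[OF Xf u] cod.Comp_Hom[OF Yf v] p sq' coc])
        fix g assume g: "g \<in> Ob (latching_cat C b)"
        note gg = gH[OF g, unfolded good_def fg(3)[OF g]]
        note Xg = fun_objectD(2)[OF X fg(4)[OF g], unfolded fg(5)[OF g]]
          and Yg = fun_objectD(2)[OF Y fg(4)[OF g], unfolded fg(5)[OF g]]
        have X4: "FAr X (Comp C f g) = Comp M (FAr X f) (FAr X g)" and Y4: "FAr Y (Comp C f g) = Comp M (FAr Y f) (FAr Y g)"
          using fun_objectD(4)[OF X fg(4)[OF g] fA] fun_objectD(4)[OF Y fg(4)[OF g] fA] fg(5)[OF g]
          by (simp_all add: b_def)
        show "Comp M (H (Comp C f g)) (Cmp t (Dom C g)) = Comp M (Comp M u (FAr X f)) (FAr X g)"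
          using gg X4 cod.assoc_Hom[OF Xg Xf u] by simp
        show "Comp M p (H (Comp C f g)) = Comp M (Comp M v (FAr Y f)) (FAr Y g)"
          using gg Y4 cod.assoc_Hom[OF Yg Yf v] by simp
      qed blast
      then show ?thesis unfolding good_def b_def by metis
    qed
    then obtain H' where H': "\<And>f. \<lbrakk>f \<in> S; deg (Dom C f) = n\<rbrakk> \<Longrightarrow> good f (H' f) \<and>
        (\<forall>g\<in>Ob (latching_cat C (Dom C f)). H (Comp C f g) = Comp M (H' f) (FAr Y g))"
      by metis
    \<comment> \<open>Lifts from degrees below \<open>n\<close> are kept, so the new ones at degree \<open>n\<close> stay compatible with them.\<close>
    define H'' where "H'' f = (if deg (Dom C f) < n then H f else H' f)" for f
    have "good f (H'' f) \<and> (\<forall>g\<in>Ob (latching_cat C (Dom C f)). H'' (Comp C f g) = Comp M (H'' f) (FAr Y g))"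
      if f: "f \<in> S" and deg: "deg (Dom C f) < Suc n" for f
    proof -
      have "H'' (Comp C f g) = H (Comp C f g)" if g: "g \<in> Ob (latching_cat C (Dom C f))" for g
      proof -
        have g': "g \<in> Ar C" "Cod C g = Dom C f" "g \<noteq> Id C (Dom C f)"
          using g by (auto simp: latching_cat_simps)
        have "g \<noteq> Id C (Dom C g)"
          using g' dom.Cod_Id[OF dom.Dom_Ob[OF g'(1)]] by auto
        then have "deg (Dom C g) < deg (Dom C f)" using raises_degree[OF g'(1)] g'(2) by simp
        moreover have "Dom C (Comp C f g) = Dom C g"
          using dom.Dom_Comp[OF g'(1) _ g'(2)] f by (simp add: S_def)
        ultimately show ?thesis using deg by (simp add: H''_def)
      qed
      then show ?thesis
        using Hgood[OF f] Hnat[OF f] H'[OF f] deg by (cases "deg (Dom C f) < n") (auto simp: H''_def)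
    qed
    then show ?case by blast
  qed
  \<comment> \<open>The identity of \<open>a\<close> is an arrow from degree \<open>deg a\<close>.\<close>
  from this[of "Suc (deg a)"] obtain H where H: "\<And>f. \<lbrakk>f \<in> S; deg (Dom C f) < Suc (deg a)\<rbrakk> \<Longrightarrow> good f (H f)"
    by blast
  have "good (Id C a) (H (Id C a))"
    by (rule H) (use a dom.Id_Ar dom.Dom_Id dom.Cod_Id in \<open>auto simp: S_def\<close>)
  then have "H (Id C a) \<in> Hom M (FOb Y a) (Dom M p)" "Comp M (H (Id C a)) (Cmp t a) = u" "Comp M p (H (Id C a)) = v"
    using a fun_objectD(3)[OF X] fun_objectD(3)[OF Y] cod.Comp_Id_Hom[OF u] cod.Comp_Id_Hom[OF v]
    by (simp_all add: good_def dom.Dom_Id)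
  then show "\<exists>h\<in>Hom M (Cod M (Cmp t a)) (Dom M p). Comp M h (Cmp t a) = u \<and> Comp M p h = v"
    unfolding ends by blast
qed

text \<open>
  The retract argument: factor \<open>f = p i\<close> and lift \<open>f\<close> against the trivial fibration \<open>p\<close>.
\<close>

lemma (in model_category) Cof_if_lifting:
  assumes f: "f \<in> Ar M" and lift: "\<And>p. p \<in> TFib M \<Longrightarrow> has_lifting M f p"
  shows "f \<in> Cof M"
proof -
  obtain i p where i: "i \<in> Cof M" and p: "p \<in> TFib M" and ip: "Cod M i = Dom M p" "f = Comp M p i"
    using factor_Cof_TFib[OF f] by blast
  have iA: "i \<in> Ar M" and pA: "p \<in> Ar M" using i p Cof_Ar Fib_Ar by (auto simp: TFib_def)
  have ends: "Dom M f = Dom M i" "Cod M f = Cod M p"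
    using Dom_Comp[OF iA pA ip(1)] Cod_Comp[OF iA pA ip(1)] ip(2) by auto
  have iH: "i \<in> Hom M (Dom M f) (Dom M p)" and pH: "p \<in> Hom M (Dom M p) (Cod M f)"
    and fH: "f \<in> Hom M (Dom M f) (Cod M f)"
    using iA pA f ip ends by (auto simp: Hom_def)
  have D: "Id M (Dom M f) \<in> Hom M (Dom M f) (Dom M f)" and C: "Id M (Cod M f) \<in> Hom M (Cod M f) (Cod M f)"
    using Id_Hom Hom_Ob[OF fH] by auto
  obtain h where h: "h \<in> Hom M (Cod M f) (Dom M p)" "Comp M h f = i" "Comp M p h = Id M (Cod M f)"
    using lift[OF p] iH C Id_Comp_Hom[OF fH] ip(2) ends unfolding has_lifting_def by metis
  have "retract_of M f i"
    unfolding retract_of_def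
    using f iA ends ip h D pH Id_Comp_Hom[OF D] Comp_Id_Hom[OF iH] Comp_Id_Hom[OF fH] by metis
  then show ?thesis using Cof_retract[OF i] by blast
qed

theorem proposition3p1:
  fixes C :: "('u::infinite, 'u) cat"
    and deg :: "'u \<Rightarrow> nat"
    and M :: "('o, 'm) model_cat"
  assumes "direct_reedy C deg"
    and "model_category M TYPE('u)"
  shows "(\<forall>t\<in>Ar (reedy C M). (\<forall>a\<in>Ob C. flat M (Cmp t a)) \<longrightarrow> flat (reedy C M) t) \<and>
    (strong_left_proper M \<longrightarrow> strong_left_proper (reedy C M))"
proof -
  interpret direct_reedy C deg by fact
  interpret M: model_category M "TYPE('u)" by fact
  have cat: "category C" "category M" by unfold_locales
  have has: "has_pushouts M" "has_pullbacks M"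
    using has_pushouts_if_small_colimits[OF cat(2) M.cocomplete]
      has_pullbacks_if_small_limits[OF cat(2) M.complete] .
  interpret D: diagrams C M
    by (intro diagrams.intro functor_category.intro diagrams_axioms.intro cat M.cocomplete)
  have flat: "flat (reedy C M) t" if "t \<in> Ar (reedy C M)" "\<forall>a\<in>Ob C. flat M (Cmp t a)" for t
    using M.flat_if_pointwise[OF cat(1) has] that by (simp add: reedy_simps)
  moreover have "flat (reedy C M) t" if M: "strong_left_proper M" and t: "t \<in> Cof (reedy C M)" for t
  proof (rule flat)
    have tA: "t \<in> fun_arrows C M" and cof: "\<And>b. b \<in> Ob C \<Longrightarrow> relative_latching_map C M t b \<in> Cof M"
      using t by (auto simp: reedy_simps)
    show "t \<in> Ar (reedy C M)" using tA by (simp add: reedy_simps)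
    have "Cmp t a \<in> Cof M" if a: "a \<in> Ob C" for a
    proof (rule M.Cof_if_lifting)
      show "Cmp t a \<in> Ar M" using D.fun_arrowD(3)[OF tA a] by (simp add: Hom_def)
      fix p assume p: "p \<in> TFib M"
      then have "p \<in> Ar M" using M.Fib_Ar by (auto simp: TFib_def)
      then show "has_lifting M (Cmp t a) p"
        using D.pointwise_lifting[OF assms(1) has(1) tA _ _ a] M.lift_Cof_TFib[OF cof p] by blast
    qed
    then show "\<forall>a\<in>Ob C. flat M (Cmp t a)" using M by (simp add: strong_left_proper_def)
  qed
  ultimately show ?thesis by (simp add: strong_left_proper_def)
qed

end
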